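(* Consider the system $$\dot{\mathbf y}=A(s)\mathbf y,\qquad \dot s=1,\qquad \mathbf y\in\mathbb R^n,\ s\in\mathbb S^1,$$ where $A(s)$ is a $2\pi$-periodic matrix. Let the Floquet exponents $\boldsymbol\mu=(\mu_1,\dots,\mu_n)$ (eigenvalues of the Floquet stability matrix $B$) be distinct. Any vector-valued function $\mathbf G(\mathbf y,s)$ that is analytic in $\mathbf y$ and $L^2$ in $s$ can be expanded into eigenfunctions of the Koopman operator associated with the system as $$\mathbf G(\mathbf y,s)=\sum_{\mathbf m\in\mathbb N^n,\,k\in\mathbb Z}\mathbf a_{\mathbf mk}\,\mathbf z^{\mathbf m}(\mathbf y,s)\,e^{iks},$$ where $\mathbf a_{\mathbf mk}$ are constant Koopman modes, $\mathbf m=(m_1,\dots,m_n)$, $\mathbf z(\mathbf y,s)=(z_1(\mathbf y,s),\dots,z_n(\mathbf y,s))$ are the principal Koopman eigenfunctions defined by $$\mathbf z(\mathbf y,s)=V^{-1}P^{-1}(s)\mathbf y,$$ where $P(s)$ is the Floquet periodic matrix and $V$ diagonalizes $B$, and $$\mathbf z^{\mathbf m}(\mathbf y,s)e^{iks}=z_1^{m_1}(\mathbf y,s)\cdots z_n^{m_n}(\mathbf y,s)e^{iks}$$ is an eigenfunction of the Koopman operator corresponding to the eigenvalue $e^{(\mathbf m\cdot\boldsymbol\mu+ik)t}$.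
   Context: $U^tf=f\circ S^t$ is the Koopman operator of the flow $S^t$; an eigenfunction with eigenvalue $e^{\lambda t}$ satisfies $U^t\phi=e^{\lambda t}\phi$. $\mathbb N$ includes $0$. Floquet theory: there are a $2\pi$-periodic invertible (in general complex) matrix $P(s)$ and a constant matrix $B$ such that $\mathbf y=P(s)\tilde{\mathbf y}$ transforms the system into $\dot{\tilde{\mathbf y}}=B\tilde{\mathbf y}$; $V$ is such that $V^{-1}BV=\mathrm{diag}(\mu_1,\dots,\mu_n)$. "Analytic in $\mathbf y$ and $L^2$ in $s$" means $\mathbf G=\sum_{\mathbf m}\mathbf b_{\mathbf m}(s)\mathbf y^{\mathbf m}$ (convergent power series in $\mathbf y$) with square integrable $2\pi$-periodic coefficients; the Fourier expansions in $s$ converge in $L^2$. The system arises from a $C^2$ vector field in $\mathbb R^{n+1}$ with a stable limit cycle, so $A$ may be taken continuous. *)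

theory Defs
  imports "HOL-Analysis.Analysis"
begin

text \<open>
  The state space \<open>\<real>\<^sup>n \<times> S\<^sup>1\<close> is represented by its cover \<open>(real^'n) \<times> real\<close>; a function on
  the state space is a function on the cover that is \<open>2\<pi>\<close>-periodic in the last argument.
\<close>

definition flow_of :: "('x::real_normed_vector \<Rightarrow> 'x) \<Rightarrow> (real \<Rightarrow> 'x \<Rightarrow> 'x) \<Rightarrow> bool" where
  "flow_of F S \<longleftrightarrow>
     (\<forall>x. S 0 x = x \<and> (\<forall>t. ((\<lambda>t. S t x) has_vector_derivative F (S t x)) (at t)))"

definition skew_field :: "(real \<Rightarrow> real^'n^'n) \<Rightarrow> (real^'n) \<times> real \<Rightarrow> (real^'n) \<times> real" where
  "skew_field A = (\<lambda>(y, s). (A s *v y, 1))"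

definition koopman :: "(real \<Rightarrow> 'x \<Rightarrow> 'x) \<Rightarrow> real \<Rightarrow> ('x \<Rightarrow> 'c) \<Rightarrow> 'x \<Rightarrow> 'c" where
  "koopman S t f = f \<circ> S t"

definition circle_periodic :: "('x \<times> real \<Rightarrow> 'c) \<Rightarrow> bool" where
  "circle_periodic f \<longleftrightarrow> (\<forall>y s. f (y, s + 2 * pi) = f (y, s))"

text \<open>Eigenfunctions are required to be well defined on the state space and not identically zero.
  The eigenvalue of the time-\<open>t\<close> operator is \<open>exp (ev t)\<close>.\<close>

definition koopman_eigenfunction ::
    "(real \<Rightarrow> 'x \<times> real \<Rightarrow> 'x \<times> real) \<Rightarrow> complex \<Rightarrow> ('x \<times> real \<Rightarrow> complex) \<Rightarrow> bool" where
  "koopman_eigenfunction S ev \<phi> \<longleftrightarrow>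
     circle_periodic \<phi> \<and> (\<exists>x. \<phi> x \<noteq> 0) \<and>
     (\<forall>t. koopman S t \<phi> = (\<lambda>x. exp (ev * of_real t) * \<phi> x))"

text \<open>The substitution \<open>y = P(s) w\<close> carries \<open>y' = A(s) y, s' = 1\<close> into \<open>w' = B w\<close>: along
  every phase line \<open>s = s0 + t\<close>, solutions of the two systems correspond. Since \<open>P\<close> and \<open>B\<close> may be
  complex, the real system is complexified.\<close>

definition floquet_form ::
    "(real \<Rightarrow> real^'n^'n) \<Rightarrow> (real \<Rightarrow> complex^'n^'n) \<Rightarrow> complex^'n^'n \<Rightarrow> bool" where
  "floquet_form A P B \<longleftrightarrow>
     (\<forall>s. P (s + 2 * pi) = P s) \<and> (\<forall>s. invertible (P s)) \<and>
     (\<forall>s0 w. (\<forall>t. (w has_vector_derivative B *v w t) (at t)) \<longleftrightarrow>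
        (\<forall>t. ((\<lambda>t. P (s0 + t) *v w t) has_vector_derivative
               map_matrix of_real (A (s0 + t)) *v (P (s0 + t) *v w t)) (at t)))"

definition mpow :: "'a::comm_monoid_mult ^ 'n \<Rightarrow> ('n \<Rightarrow> nat) \<Rightarrow> 'a" where
  "mpow x m = (\<Prod>i\<in>UNIV. x $ i ^ m i)"

definition floquet_coord ::
    "(real \<Rightarrow> complex^'n^'n) \<Rightarrow> complex^'n^'n \<Rightarrow> real^'n \<Rightarrow> real \<Rightarrow> complex^'n" where
  "floquet_coord P V y s = matrix_inv V *v (matrix_inv (P s) *v (\<chi> i. of_real (y $ i)))"

definition fourier_char :: "int \<Rightarrow> real \<Rightarrow> complex" where
  "fourier_char k s = exp (\<i> * of_int k * of_real s)"

text \<open>Lebesgue measure on one period, i.e. on the circle.\<close>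

abbreviation circle_measure :: "real measure" where
  "circle_measure \<equiv> lebesgue_on {0..2 * pi}"

definition L2_circle :: "(real \<Rightarrow> 'c::euclidean_space) \<Rightarrow> bool" where
  "L2_circle f \<longleftrightarrow>
     f \<in> borel_measurable circle_measure \<and> integrable circle_measure (\<lambda>s. (norm (f s))\<^sup>2)"

definition L2_norm :: "(real \<Rightarrow> 'c::euclidean_space) \<Rightarrow> real" where
  "L2_norm f = sqrt (\<integral>s. (norm (f s))\<^sup>2 \<partial>circle_measure)"

text \<open>Unconditional convergence in \<open>L\<^sup>2\<close> of the circle (the analogue of \<open>has_sum\<close>).\<close>

definition L2_has_sum ::
    "('i \<Rightarrow> real \<Rightarrow> 'c::euclidean_space) \<Rightarrow> (real \<Rightarrow> 'c) \<Rightarrow> 'i set \<Rightarrow> bool" where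
  "L2_has_sum f g I \<longleftrightarrow>
     (\<forall>i\<in>I. L2_circle (f i)) \<and> L2_circle g \<and>
     ((\<lambda>F. L2_norm (\<lambda>s. g s - (\<Sum>i\<in>F. f i s))) \<longlongrightarrow> 0) (finite_subsets_at_top I)"

text \<open>\<open>G\<close> is given for \<open>|y| < R\<close> by a convergent power series in \<open>y\<close> with square integrable periodic
  coefficients; \<open>R = \<infinity>\<close> is the case of a series convergent on all of \<open>\<real>\<^sup>n\<close>. As is
  usual for \<open>L\<^sup>2\<close> objects, null sets of phases are disregarded.\<close>

definition analytic_L2 ::
    "ereal \<Rightarrow> (('n::finite \<Rightarrow> nat) \<Rightarrow> real \<Rightarrow> complex^'q) \<Rightarrow> ((real^'n) \<times> real \<Rightarrow> complex^'q) \<Rightarrow> bool"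
    where
  "analytic_L2 R b G \<longleftrightarrow>
     circle_periodic G \<and>
     (\<forall>m. L2_circle (b m) \<and> (\<forall>s. b m (s + 2 * pi) = b m s)) \<and>
     (AE s in circle_measure. \<forall>y. ereal (norm y) < R \<longrightarrow>
        ((\<lambda>m. mpow y m *\<^sub>R b m s) has_sum G (y, s)) UNIV)"

end

theory Submission
  imports Defs
begin

text \<open>
  Along a solution, \<open>z = V\<^sup>-\<^sup>1 P(s)\<^sup>-\<^sup>1 y\<close> solves \<open>z' = diag(\<mu>) z\<close>, so every monomial
  \<open>z\<^sup>m e\<^sup>i\<^sup>k\<^sup>s\<close> is multiplied by an exponential. For the expansion, put \<open>Q(s) = P(s) V\<close> and
  substitute \<open>y = Q(s) z\<close> into the power series: a monomial of degree \<open>d\<close> in \<open>y\<close> becomes a form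
  of degree \<open>d\<close> in \<open>z\<close> with coefficients continuous in \<open>s\<close> and of total size at most \<open>L\<^sup>d\<close>,
  uniformly in \<open>s\<close>. Hence the sums over \<open>|m| \<le> N\<close> of both series coincide, and comparison
  with a geometric series gives absolute convergence, pointwise and in \<open>L\<^sup>2\<close>, on a ball that is
  smaller by a constant factor. The coefficients \<open>c\<^sub>m(s)\<close> are then expanded into Fourier
  series, whose \<open>L\<^sup>2\<close> convergence follows from the density of trigonometric polynomials and
  Bessel's inequality.
\<close>

section \<open>The space of square integrable functions on the circle\<close>

text \<open>Two kinds of summation compete. Grouped by degree, the grouped series converges on the
  whole ball of radius \<open>R\<close>. Summed monomial by monomial, the expanded forms lose
  cancellation: (y1 + y2)^d has coefficients of total size 2^d, however small y1 + y2 may be. The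
  coefficients are therefore controlled through a majorant, and the price is the factor
  \<open>\<eta>\<close>, which depends neither on \<open>y\<close>, \<open>s\<close> nor on
  \<open>G\<close> and leaves an infinite radius infinite. Fourier series converge in L2
  unconditionally but in general not absolutely, so absolute summability does not yield the joint
  series over \<open>(m, k)\<close>. Bessel's inequality helps: every finite part of the Fourier
  series of \<open>c m\<close>, however badly chosen, has norm at most that of \<open>c m\<close>,
  and these norms are summable against the bounds of the monomials. The correspondence of solutions
  given by \<open>P\<close> is used in both directions: from \<open>w\<close> to \<open>y\<close>
  for the continuity of P V, from \<open>y\<close> to \<open>w\<close> for the evolution of
  \<open>z\<close>. Continuity of \<open>z\<close> in the phase then comes from Cramer's
  rule.\<close>

lemma norm_vector_scalar_mult:
  fixes v :: "('a::real_normed_field)^'q"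
  shows "norm (c *s v) = norm c * norm v"
  by (simp add: norm_vec_def vector_scalar_mult_def norm_mult L2_set_right_distrib)

lemma finite_measure_circle: "finite_measure circle_measure"
  by (intro finite_measure_lebesgue_on) auto

lemma measure_circle: "measure circle_measure {0..2 * pi} = 2 * pi"
  by (simp add: measure_restrict_space)

lemma continuous_imp_measurable_circle:
  fixes f :: "real \<Rightarrow> 'c::euclidean_space"
  assumes "continuous_on {0..2 * pi} f"
  shows "f \<in> borel_measurable circle_measure"
  by (rule continuous_imp_measurable_on_sets_lebesgue[OF assms]) simp

lemma L2_circle_dominated:
  fixes f :: "real \<Rightarrow> 'c::euclidean_space" and g :: "real \<Rightarrow> real"
  assumes "f \<in> borel_measurable circle_measure" "integrable circle_measure g"
    and "\<And>s. s \<in> {0..2 * pi} \<Longrightarrow> (norm (f s))\<^sup>2 \<le> g s"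
  shows "L2_circle f"
  unfolding L2_circle_def
proof (intro conjI)
  show "integrable circle_measure (\<lambda>s. (norm (f s))\<^sup>2)"
    by (rule Bochner_Integration.integrable_bound[OF assms(2)])
      (use assms in \<open>auto intro!: AE_I2 order_trans[OF _ abs_ge_self]\<close>)
qed (use assms in auto)

lemma L2_circle_bounded:
  fixes f :: "real \<Rightarrow> 'c::euclidean_space"
  assumes "f \<in> borel_measurable circle_measure" "\<And>s. s \<in> {0..2 * pi} \<Longrightarrow> norm (f s) \<le> C"
  shows "L2_circle f"
proof (rule L2_circle_dominated[OF assms(1)])
  show "integrable circle_measure (\<lambda>s. C\<^sup>2)"
    using finite_measure.integrable_const[OF finite_measure_circle] by blast
qed (use assms in \<open>auto intro: power_mono\<close>)

lemma L2_circle_continuous: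
  fixes f :: "real \<Rightarrow> 'c::euclidean_space"
  assumes "continuous_on {0..2 * pi} f"
  shows "L2_circle f"
proof -
  have "bounded (f ` {0..2 * pi})"
    by (intro compact_imp_bounded compact_continuous_image assms) auto
  then obtain C where "\<forall>s\<in>{0..2 * pi}. norm (f s) \<le> C" by (auto simp: bounded_iff)
  then show ?thesis by (intro L2_circle_bounded[of _ C] continuous_imp_measurable_circle assms) auto
qed

lemma L2_circle_add:
  fixes f g :: "real \<Rightarrow> 'c::euclidean_space"
  assumes "L2_circle f" "L2_circle g"
  shows "L2_circle (\<lambda>s. f s + g s)"
proof (rule L2_circle_dominated)
  show "integrable circle_measure (\<lambda>s. 2 * (norm (f s))\<^sup>2 + 2 * (norm (g s))\<^sup>2)"
    using assms by (auto simp: L2_circle_def)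
  show "(norm (f s + g s))\<^sup>2 \<le> 2 * (norm (f s))\<^sup>2 + 2 * (norm (g s))\<^sup>2" for s
  proof -
    have "(norm (f s + g s))\<^sup>2 \<le> (norm (f s) + norm (g s))\<^sup>2"
      by (intro power_mono norm_triangle_ineq) auto
    also have "\<dots> \<le> 2 * (norm (f s))\<^sup>2 + 2 * (norm (g s))\<^sup>2"
      using sum_squares_bound[of "norm (f s)" "norm (g s)"] by (simp add: power2_sum)
    finally show ?thesis .
  qed
qed (use assms in \<open>auto simp: L2_circle_def\<close>)

lemma L2_circle_minus:
  fixes f :: "real \<Rightarrow> 'c::euclidean_space"
  shows "L2_circle f \<Longrightarrow> L2_circle (\<lambda>s. - f s)"
  by (auto simp: L2_circle_def)

lemma L2_circle_diff:
  fixes f g :: "real \<Rightarrow> 'c::euclidean_space"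
  assumes "L2_circle f" "L2_circle g"
  shows "L2_circle (\<lambda>s. f s - g s)"
  using L2_circle_add[OF assms(1) L2_circle_minus[OF assms(2)]] by simp

lemma L2_circle_sum:
  fixes f :: "'i \<Rightarrow> real \<Rightarrow> 'c::euclidean_space"
  assumes "\<And>i. i \<in> I \<Longrightarrow> L2_circle (f i)"
  shows "L2_circle (\<lambda>s. \<Sum>i\<in>I. f i s)"
  using assms
proof (induction I rule: infinite_finite_induct)
  case (insert x F)
  then show ?case by (simp add: L2_circle_add)
qed (auto simp: L2_circle_def)

lemma L2_norm_nonneg [simp]: "0 \<le> L2_norm f"
  by (simp add: L2_norm_def)

lemma L2_norm_zero [simp]: "L2_norm (\<lambda>_. 0) = 0"
  by (simp add: L2_norm_def)

lemma L2_norm_power2: "(L2_norm f)\<^sup>2 = (\<integral>s. (norm (f s))\<^sup>2 \<partial>circle_measure)"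
  by (simp add: L2_norm_def)

lemma L2_norm_minus_commute: "L2_norm (\<lambda>s. f s - g s) = L2_norm (\<lambda>s. g s - f s)"
  by (simp add: L2_norm_def norm_minus_commute)

text \<open>Minkowski's inequality from a weighted pointwise estimate: (x + y)^2 \<le> (1 + b/a) x^2
  + (1 + a/b) y^2, integrated with \<open>a\<close> and \<open>b\<close> slightly above the two
  norms, gives the bound (a + b)^2. The slack e/2 keeps the weights defined when a norm
  vanishes.\<close>

lemma L2_norm_triangle:
  fixes f g :: "real \<Rightarrow> 'c::euclidean_space"
  assumes "L2_circle f" "L2_circle g"
  shows "L2_norm (\<lambda>s. f s + g s) \<le> L2_norm f + L2_norm g"
proof (rule field_le_epsilon)
  fix e :: real assume "0 < e"
  define a where "a = L2_norm f + e / 2"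
  define b where "b = L2_norm g + e / 2"
  have ab: "0 < a" "0 < b" using \<open>0 < e\<close> by (auto simp: a_def b_def intro!: add_nonneg_pos)
  have I: "integrable circle_measure (\<lambda>s. (norm (f s))\<^sup>2)" "integrable circle_measure (\<lambda>s. (norm (g s))\<^sup>2)"
    "integrable circle_measure (\<lambda>s. (norm (f s + g s))\<^sup>2)"
    using assms L2_circle_add[OF assms] by (auto simp: L2_circle_def)
  have pw: "(x + y)\<^sup>2 \<le> (1 + b / a) * x\<^sup>2 + (1 + a / b) * y\<^sup>2" for x y
  proof -
    have "0 \<le> (b * x - a * y)\<^sup>2 / (a * b)" using ab by simp
    also have "\<dots> = (1 + b / a) * x\<^sup>2 + (1 + a / b) * y\<^sup>2 - (x + y)\<^sup>2"
      using ab by (simp add: field_simps power2_eq_square)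
    finally show ?thesis by simp
  qed
  have "(L2_norm (\<lambda>s. f s + g s))\<^sup>2 
      \<le> (\<integral>s. (1 + b / a) * (norm (f s))\<^sup>2 + (1 + a / b) * (norm (g s))\<^sup>2 \<partial>circle_measure)"
    unfolding L2_norm_power2
  proof (intro integral_mono I Bochner_Integration.integrable_add integrable_mult_right)
    fix s
    have "(norm (f s + g s))\<^sup>2 \<le> (norm (f s) + norm (g s))\<^sup>2"
      by (intro power_mono norm_triangle_ineq) auto
    then show "(norm (f s + g s))\<^sup>2 \<le> (1 + b / a) * (norm (f s))\<^sup>2 + (1 + a / b) * (norm (g s))\<^sup>2"
      using pw[of "norm (f s)" "norm (g s)"] by linarith
  qed
  also have "\<dots> = (1 + b / a) * (L2_norm f)\<^sup>2 + (1 + a / b) * (L2_norm g)\<^sup>2"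
    using I by (simp add: L2_norm_power2)
  also have "\<dots> \<le> (1 + b / a) * a\<^sup>2 + (1 + a / b) * b\<^sup>2"
    using ab \<open>0 < e\<close> by (intro add_mono mult_left_mono power_mono) (auto simp: a_def b_def)
  also have "\<dots> = (a + b)\<^sup>2"
    using ab by (simp add: field_simps power2_eq_square)
  finally have "L2_norm (\<lambda>s. f s + g s) \<le> a + b"
    by (rule power2_le_imp_le) (use ab in auto)
  then show "L2_norm (\<lambda>s. f s + g s) \<le> L2_norm f + L2_norm g + e"
    by (simp add: a_def b_def)
qed

lemma L2_norm_diff_triangle:
  fixes f g h :: "real \<Rightarrow> 'c::euclidean_space"
  assumes "L2_circle f" "L2_circle g" "L2_circle h"
  shows "L2_norm (\<lambda>s. f s - h s) \<le> L2_norm (\<lambda>s. f s - g s) + L2_norm (\<lambda>s. g s - h s)"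
  using L2_norm_triangle[OF L2_circle_diff[OF assms(1,2)] L2_circle_diff[OF assms(2,3)]] by simp

lemma L2_norm_sum:
  fixes f :: "'i \<Rightarrow> real \<Rightarrow> 'c::euclidean_space"
  assumes "\<And>i. i \<in> I \<Longrightarrow> L2_circle (f i)"
  shows "L2_norm (\<lambda>s. \<Sum>i\<in>I. f i s) \<le> (\<Sum>i\<in>I. L2_norm (f i))"
  using assms
proof (induction I rule: infinite_finite_induct)
  case (insert x F)
  then have "L2_norm (\<lambda>s. f x s + (\<Sum>i\<in>F. f i s)) \<le> L2_norm (f x) + L2_norm (\<lambda>s. \<Sum>i\<in>F. f i s)"
    by (intro L2_norm_triangle L2_circle_sum) auto
  with insert show ?case by simp
qed auto

lemma borel_measurable_vector_scalar_mult:
  fixes f :: "real \<Rightarrow> complex^'q"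
  assumes "h \<in> borel_measurable M" "f \<in> borel_measurable M"
  shows "(\<lambda>s. h s *s f s) \<in> borel_measurable M"
  using assms
  by (rule borel_measurable_continuous_Pair)
    (auto simp: vector_scalar_mult_def intro!: continuous_intros)

lemma L2_circle_scale:
  fixes f :: "real \<Rightarrow> complex^'q"
  assumes "h \<in> borel_measurable circle_measure" "L2_circle f"
    and "\<And>s. s \<in> {0..2 * pi} \<Longrightarrow> norm (h s) \<le> C"
  shows "L2_circle (\<lambda>s. h s *s f s)" "L2_norm (\<lambda>s. h s *s f s) \<le> C * L2_norm f"
proof -
  have C: "0 \<le> C" using assms(3)[of 0] by (auto intro: order_trans[OF norm_ge_zero])
  have le: "(norm (h s *s f s))\<^sup>2 \<le> C\<^sup>2 * (norm (f s))\<^sup>2" if "s \<in> {0..2 * pi}" for s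
    unfolding norm_vector_scalar_mult power_mult_distrib[symmetric]
    by (intro power_mono mult_right_mono assms that) auto
  have I: "integrable circle_measure (\<lambda>s. C\<^sup>2 * (norm (f s))\<^sup>2)"
    using assms(2) by (auto simp: L2_circle_def)
  show L: "L2_circle (\<lambda>s. h s *s f s)"
    by (rule L2_circle_dominated[OF _ I le])
      (use assms in \<open>auto simp: L2_circle_def intro!: borel_measurable_vector_scalar_mult\<close>)
  have "(L2_norm (\<lambda>s. h s *s f s))\<^sup>2 \<le> (\<integral>s. C\<^sup>2 * (norm (f s))\<^sup>2 \<partial>circle_measure)"
    unfolding L2_norm_power2 using L I le by (intro integral_mono) (auto simp: L2_circle_def)
  also have "\<dots> = (C * L2_norm f)\<^sup>2"
    by (simp add: power_mult_distrib L2_norm_power2)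
  finally show "L2_norm (\<lambda>s. h s *s f s) \<le> C * L2_norm f"
    by (rule power2_le_imp_le) (use C in auto)
qed

section \<open>Fourier series\<close>

lemma fourier_char_cis: "fourier_char k s = cis (of_int k * s)"
  by (simp add: fourier_char_def cis_conv_exp mult.assoc)

lemma fourier_char_zero [simp]: "fourier_char 0 s = 1"
  by (simp add: fourier_char_def)

lemma fourier_char_add: "fourier_char (k + l) s = fourier_char k s * fourier_char l s"
  by (simp add: fourier_char_cis cis_mult distrib_right)

lemma fourier_char_diff: "fourier_char (k - l) s = fourier_char k s * fourier_char (- l) s"
  using fourier_char_add[of k "- l"] by simp

lemma cnj_fourier_char: "cnj (fourier_char k s) = fourier_char (- k) s"
  by (simp add: fourier_char_cis cis_cnj)

lemma continuous_on_fourier_char [continuous_intros]: "continuous_on X (fourier_char k)"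
  unfolding fourier_char_def by (intro continuous_intros)

lemma fourier_char_periodic: "fourier_char k (s + 2 * pi) = fourier_char k s"
proof -
  have "cis (of_int k * (s + 2 * pi)) = cis (of_int k * s) * cis (2 * pi * of_int k)"
    by (simp add: cis_mult algebra_simps)
  then show ?thesis by (simp add: fourier_char_cis cis_multiple_2pi)
qed

lemma integrable_circle_continuous:
  fixes f :: "real \<Rightarrow> 'c::euclidean_space"
  assumes "continuous_on {0..2 * pi} f"
  shows "integrable circle_measure f"
  by (rule continuous_imp_integrable_real[OF assms])

lemma integral_fourier_char:
  "(\<integral>s. fourier_char k s \<partial>circle_measure) = (if k = 0 then 2 * pi else 0)"
proof (cases "k = 0")
  case True
  then show ?thesis by (simp add: measure_circle scaleR_conv_of_real)
next
  case False
  have "((\<lambda>s. fourier_char k s / (\<i> * of_int k)) has_vector_derivative fourier_char k s) (at s within {0..2 * pi})" for s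
    unfolding fourier_char_def using False
    by (auto intro!: derivative_eq_intros has_vector_derivative_real_field)
  then have "((\<lambda>s. fourier_char k s) has_integral 
      fourier_char k (2 * pi) / (\<i> * of_int k) - fourier_char k 0 / (\<i> * of_int k)) {0..2 * pi}"
    by (intro fundamental_theorem_of_calculus) auto
  moreover have "fourier_char k (2 * pi) = fourier_char k 0"
    using fourier_char_periodic[of k 0] by simp
  ultimately have "integral {0..2 * pi} (fourier_char k) = 0"
    by (simp add: integral_unique)
  then show ?thesis
    using False lebesgue_integral_eq_integral[OF integrable_circle_continuous[OF continuous_on_fourier_char, of k]]
    by simp
qed

section \<open>Fourier coefficients, best approximation and Bessel's inequality\<close>

definition fourier_coeff :: "(real \<Rightarrow> complex) \<Rightarrow> int \<Rightarrow> complex" where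
  "fourier_coeff f k = (\<integral>s. f s * fourier_char (- k) s \<partial>circle_measure) / (2 * pi)"

lemma integrable_L2_mult:
  fixes f g :: "real \<Rightarrow> complex"
  assumes "L2_circle f" "L2_circle g"
  shows "integrable circle_measure (\<lambda>s. f s * g s)"
proof (rule Bochner_Integration.integrable_bound)
  show "integrable circle_measure (\<lambda>s. (norm (f s))\<^sup>2 + (norm (g s))\<^sup>2)"
    using assms by (auto simp: L2_circle_def)
  have "norm (f s * g s) \<le> (norm (f s))\<^sup>2 + (norm (g s))\<^sup>2" for s
    using sum_squares_bound[of "norm (f s)" "norm (g s)"] mult_nonneg_nonneg[OF norm_ge_zero norm_ge_zero, of "f s" "g s"]
    unfolding norm_mult by linarith
  then show "AE s in circle_measure. norm (f s * g s) \<le> norm ((norm (f s))\<^sup>2 + (norm (g s))\<^sup>2)"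
    by auto
qed (use assms in \<open>auto simp: L2_circle_def\<close>)

lemma L2_circle_trig: "L2_circle (\<lambda>s. \<Sum>k\<in>K. p k * fourier_char k s)"
  by (intro L2_circle_continuous continuous_intros)

text \<open>Finite Parseval identity. The squared modulus is read as a product with the conjugate, a
  double sum of characters \<open>k - l\<close>, of which integration keeps the diagonal.\<close>

lemma L2_norm_trig_power2:
  assumes "finite K"
  shows "(L2_norm (\<lambda>s. \<Sum>k\<in>K. p k * fourier_char k s))\<^sup>2 = 2 * pi * (\<Sum>k\<in>K. (norm (p k))\<^sup>2)"
proof -
  have "complex_of_real ((L2_norm (\<lambda>s. \<Sum>k\<in>K. p k * fourier_char k s))\<^sup>2)
      = (\<integral>s. of_real ((norm (\<Sum>k\<in>K. p k * fourier_char k s))\<^sup>2) \<partial>circle_measure)"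
    unfolding L2_norm_power2 by (rule integral_complex_of_real[symmetric])
  also have "\<dots> = (\<integral>s. (\<Sum>k\<in>K. \<Sum>l\<in>K. p k * cnj (p l) * fourier_char (k - l) s) \<partial>circle_measure)"
    unfolding complex_norm_square
    by (simp add: sum_product cnj_fourier_char fourier_char_diff mult_ac)
  also have "\<dots> = (\<Sum>k\<in>K. \<Sum>l\<in>K. p k * cnj (p l) * (if k - l = 0 then 2 * pi else 0))"
    by (simp add: integrable_circle_continuous continuous_intros integral_fourier_char)
  also have "\<dots> = (\<Sum>k\<in>K. p k * cnj (p k) * (2 * pi))"
    using assms by (intro sum.cong refl) (simp add: if_distrib sum.delta cong: if_cong)
  also have "\<dots> = of_real (2 * pi * (\<Sum>k\<in>K. (norm (p k))\<^sup>2))"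
    by (simp add: complex_norm_square[symmetric] sum_distrib_left mult_ac)
  finally show ?thesis by (simp only: of_real_eq_iff)
qed

lemma norm_diff_power2_complex:
  fixes z w :: complex
  shows "(norm (z - w))\<^sup>2 = (norm z)\<^sup>2 + ((norm w)\<^sup>2 - 2 * Re (z * cnj w))"
  unfolding cmod_power2 by (simp add: power2_eq_square algebra_simps)

lemma L2_norm_diff_power2:
  fixes f g :: "real \<Rightarrow> complex"
  assumes "L2_circle f" "L2_circle g"
  shows "(L2_norm (\<lambda>s. f s - g s))\<^sup>2
     = (L2_norm f)\<^sup>2 + ((L2_norm g)\<^sup>2 - 2 * Re (\<integral>s. f s * cnj (g s) \<partial>circle_measure))"
proof -
  have cg: "L2_circle (\<lambda>s. cnj (g s))"
    using assms(2) borel_measurable_continuous_onI[OF continuous_on_cnj[OF continuous_on_id]]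
    by (auto simp: L2_circle_def intro: measurable_compose)
  have I: "integrable circle_measure (\<lambda>s. f s * cnj (g s))"
    by (rule integrable_L2_mult[OF assms(1) cg])
  have R: "integrable circle_measure (\<lambda>s. 2 * Re (f s * cnj (g s)))"
    "(\<integral>s. 2 * Re (f s * cnj (g s)) \<partial>circle_measure) = 2 * Re (\<integral>s. f s * cnj (g s) \<partial>circle_measure)"
    using integrable_Re[OF I] integral_Re[OF I] by (auto simp del: times_complex.sel)
  have "integrable circle_measure (\<lambda>s. (norm (f s))\<^sup>2)" "integrable circle_measure (\<lambda>s. (norm (g s))\<^sup>2)"
    using assms by (auto simp: L2_circle_def)
  with R show ?thesis
    unfolding L2_norm_power2 norm_diff_power2_complex
    by (simp del: times_complex.sel)
qed

text \<open>Completing the square in the coefficients: \<open>p\<close> enters only through the last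
  sum, which is nonnegative and vanishes for \<open>p = fourier_coeff f\<close>. Best approximation
  and Bessel's inequality both follow from this identity.\<close>

lemma L2_norm_diff_trig_power2:
  assumes "L2_circle f" "finite K"
  shows "(L2_norm (\<lambda>s. f s - (\<Sum>k\<in>K. p k * fourier_char k s)))\<^sup>2
    = (L2_norm f)\<^sup>2 - 2 * pi * (\<Sum>k\<in>K. (norm (fourier_coeff f k))\<^sup>2)
      + 2 * pi * (\<Sum>k\<in>K. (norm (fourier_coeff f k - p k))\<^sup>2)"
proof -
  let ?T = "\<lambda>s. \<Sum>k\<in>K. p k * fourier_char k s"
  let ?a = "fourier_coeff f"
  have LT: "L2_circle ?T" by (rule L2_circle_trig)
  have Lc: "L2_circle (fourier_char k)" for k
    by (intro L2_circle_continuous continuous_intros)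
  have int: "(\<integral>s. f s * cnj (?T s) \<partial>circle_measure) = 2 * pi * (\<Sum>k\<in>K. ?a k * cnj (p k))"
  proof -
    have "(\<integral>s. f s * cnj (?T s) \<partial>circle_measure) = 
        (\<integral>s. (\<Sum>k\<in>K. cnj (p k) * (f s * fourier_char (- k) s)) \<partial>circle_measure)"
      by (simp add: sum_distrib_left cnj_fourier_char mult_ac)
    also have "\<dots> = (\<Sum>k\<in>K. cnj (p k) * (\<integral>s. f s * fourier_char (- k) s \<partial>circle_measure))"
      by (subst Bochner_Integration.integral_sum)
        (auto intro!: integrable_mult_right integrable_L2_mult assms Lc)
    also have "\<dots> = 2 * pi * (\<Sum>k\<in>K. ?a k * cnj (p k))"
      by (simp add: fourier_coeff_def sum_distrib_left mult_ac)
    finally show ?thesis .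
  qed
  have "(L2_norm (\<lambda>s. f s - ?T s))\<^sup>2
     = (L2_norm f)\<^sup>2 + ((L2_norm ?T)\<^sup>2 - 2 * Re (\<integral>s. f s * cnj (?T s) \<partial>circle_measure))"
    by (rule L2_norm_diff_power2[OF assms(1) LT])
  also have "\<dots> = (L2_norm f)\<^sup>2 + 2 * pi * (\<Sum>k\<in>K. (norm (p k))\<^sup>2 - 2 * Re (?a k * cnj (p k)))"
    unfolding int L2_norm_trig_power2[OF assms(2)]
    by (simp add: sum_subtractf sum_distrib_left right_diff_distrib) (simp add: algebra_simps)
  also have "(\<Sum>k\<in>K. (norm (p k))\<^sup>2 - 2 * Re (?a k * cnj (p k)))
     = (\<Sum>k\<in>K. (norm (?a k - p k))\<^sup>2 - (norm (?a k))\<^sup>2)"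
    by (intro sum.cong refl) (simp only: norm_diff_power2_complex)
  finally show ?thesis by (simp add: sum_subtractf right_diff_distrib)
qed

text \<open>Extended by 0 to \<open>K'\<close>, the family \<open>p\<close> competes there with the
  Fourier coefficients. Letting \<open>K'\<close> exceed \<open>K\<close> is what later gives
  convergence along all finite sets of frequencies.\<close>

lemma L2_norm_fourier_best:
  assumes "L2_circle f" "finite K'" "K \<subseteq> K'"
  shows "L2_norm (\<lambda>s. f s - (\<Sum>k\<in>K'. fourier_coeff f k * fourier_char k s))
     \<le> L2_norm (\<lambda>s. f s - (\<Sum>k\<in>K. p k * fourier_char k s))"
proof -
  define p' where "p' k = (if k \<in> K then p k else 0)" for k
  have "(\<Sum>k\<in>K. p k * fourier_char k s) = (\<Sum>k\<in>K'. p' k * fourier_char k s)" for s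
    by (rule sum.mono_neutral_cong_left) (use assms in \<open>auto simp: p'_def\<close>)
  then show ?thesis
    by (intro power2_le_imp_le[OF _ L2_norm_nonneg])
      (simp add: L2_norm_diff_trig_power2[OF assms(1,2)] sum_nonneg)
qed

lemma L2_norm_bessel:
  assumes "L2_circle f" "finite K"
  shows "(L2_norm (\<lambda>s. \<Sum>k\<in>K. fourier_coeff f k * fourier_char k s))\<^sup>2 \<le> (L2_norm f)\<^sup>2"
proof -
  have "0 \<le> (L2_norm f)\<^sup>2 - 2 * pi * (\<Sum>k\<in>K. (norm (fourier_coeff f k))\<^sup>2)"
    using L2_norm_diff_trig_power2[OF assms, of "fourier_coeff f"]
      zero_le_power2[of "L2_norm (\<lambda>s. f s - (\<Sum>k\<in>K. fourier_coeff f k * fourier_char k s))"]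
    by simp
  then show ?thesis unfolding L2_norm_trig_power2[OF assms(2)] by linarith
qed

section \<open>Trigonometric polynomials and uniform approximation on the circle\<close>

inductive trig_poly :: "(real \<Rightarrow> complex) \<Rightarrow> bool" where
  monom: "trig_poly (\<lambda>s. c * fourier_char k s)"
| add: "trig_poly f \<Longrightarrow> trig_poly g \<Longrightarrow> trig_poly (\<lambda>s. f s + g s)"

lemma trig_poly_const: "trig_poly (\<lambda>s. c)"
  using trig_poly.monom[of c 0] by simp

lemma trig_poly_mult:
  assumes "trig_poly f" "trig_poly g"
  shows "trig_poly (\<lambda>s. f s * g s)"
  using assms
proof (induction f)
  case (monom c k)
  from monom show ?case
  proof (induction g)
    case (monom d l)
    show ?case using trig_poly.monom[of "c * d" "k + l"] by (simp add: fourier_char_add mult_ac)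
  next
    case (add g h)
    then show ?case using trig_poly.add by (auto simp: distrib_left)
  qed
next
  case (add f h)
  then show ?case using trig_poly.add by (auto simp: distrib_right)
qed

text \<open>Equal frequencies are merged after extending both coefficient families by 0 to the
  union. The inductive form suits the Stone-Weierstrass induction, the sum form suits best
  approximation.\<close>

lemma trig_poly_eq_sum:
  assumes "trig_poly f"
  obtains K p where "finite K" "f = (\<lambda>s. \<Sum>k\<in>K. p k * fourier_char k s)"
proof -
  have "\<exists>K p. finite K \<and> f = (\<lambda>s. \<Sum>k\<in>K. p k * fourier_char k s)"
    using assms
  proof induction
    case (monom c k)
    show ?case by (rule exI[of _ "{k}"], rule exI[of _ "\<lambda>_. c"]) auto
  next
    case (add f g)
    then obtain K p L q where K: "finite K" "f = (\<lambda>s. \<Sum>k\<in>K. p k * fourier_char k s)"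
      and L: "finite L" "g = (\<lambda>s. \<Sum>k\<in>L. q k * fourier_char k s)" by blast
    let ?r = "\<lambda>k. (if k \<in> K then p k else 0) + (if k \<in> L then q k else 0)"
    have "(\<Sum>k\<in>K. p k * fourier_char k s) = (\<Sum>k\<in>K \<union> L. (if k \<in> K then p k else 0) * fourier_char k s)" for s
      by (rule sum.mono_neutral_cong_left) (use K L in auto)
    moreover have "(\<Sum>k\<in>L. q k * fourier_char k s) = (\<Sum>k\<in>K \<union> L. (if k \<in> L then q k else 0) * fourier_char k s)" for s
      by (rule sum.mono_neutral_cong_left) (use K L in auto)
    ultimately have "(\<lambda>s. f s + g s) = (\<lambda>s. \<Sum>k\<in>K \<union> L. ?r k * fourier_char k s)"
      unfolding K L by (simp add: distrib_right sum.distrib)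
    then show ?case using K(1) L(1) by (intro exI[of _ "K \<union> L"] exI[of _ ?r]) simp
  qed
  with that show ?thesis by blast
qed

lemma L2_circle_trig_poly: "trig_poly f \<Longrightarrow> L2_circle f"
  by (erule trig_poly_eq_sum) (simp add: L2_circle_trig)

text \<open>On the unit circle a real linear form is a combination of cos and sin, hence of the
  characters 1 and -1; sums and products stay trigonometric polynomials. The induction follows the
  generation of real polynomials.\<close>

lemma trig_poly_real_polynomial:
  fixes g :: "complex \<Rightarrow> real"
  assumes "real_polynomial_function g"
  shows "trig_poly (\<lambda>s. of_real (g (cis s)))"
  using assms
proof induction
  case (linear f)
  interpret bounded_linear f by fact
  have f: "f z = Re z * f 1 + Im z * f \<i>" for z
  proof -
    have "z = Re z *\<^sub>R 1 + Im z *\<^sub>R \<i>" by (simp add: complex_eq_iff)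
    then have "f z = f (Re z *\<^sub>R 1 + Im z *\<^sub>R \<i>)" by simp
    then show ?thesis unfolding add scaleR by simp
  qed
  have "complex_of_real (f (cis s)) = ((f 1 - \<i> * f \<i>) / 2) * fourier_char 1 s
      + ((f 1 + \<i> * f \<i>) / 2) * fourier_char (-1) s" for s
    unfolding f[of "cis s"] by (simp add: fourier_char_cis complex_eq_iff field_simps)
  then show ?case by (simp only:) (intro trig_poly.intros)
next
  case (const c)
  show ?case by (rule trig_poly_const)
next
  case (add f g)
  then show ?case using trig_poly.add by simp
next
  case (mult f g)
  then show ?case using trig_poly_mult by simp
qed

text \<open>The lift is \<open>\<phi>\<close> after \<open>Arg2pi\<close>, which jumps at 1; there
  the equality of the end values closes the gap. Continuity is checked on closed sets: the preimage
  of a closed set is the image under \<open>cis\<close> of a compact subset of the interval, hence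
  compact.\<close>

lemma continuous_on_circle_lift:
  fixes \<phi> :: "real \<Rightarrow> 'a::topological_space"
  assumes "continuous_on {0..2 * pi} \<phi>" "\<phi> 0 = \<phi> (2 * pi)"
  obtains \<psi> where "continuous_on (sphere 0 1) \<psi>" "\<And>s. s \<in> {0..2 * pi} \<Longrightarrow> \<psi> (cis s) = \<phi> s"
proof
  let ?\<psi> = "\<lambda>z. \<phi> (Arg2pi z)"
  show eq: "?\<psi> (cis s) = \<phi> s" if "s \<in> {0..2 * pi}" for s
  proof (cases "s = 2 * pi")
    case True
    then show ?thesis using assms(2) by (simp add: Arg2pi_of_real[of 1, simplified])
  next
    case False
    then have "Arg2pi (cis s) = s"
      using that by (intro Arg2pi_unique[of 1]) (auto simp: cis_conv_exp)
    then show ?thesis by simp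
  qed
  show "continuous_on (sphere 0 1) ?\<psi>"
    unfolding continuous_on_closed_vimage[OF closed_sphere]
  proof (intro allI impI)
    fix C :: "'a set" assume "closed C"
    have "?\<psi> -` C \<inter> sphere 0 1 = cis ` (\<phi> -` C \<inter> {0..2 * pi})"
    proof (intro equalityI subsetI)
      fix z :: complex assume z: "z \<in> ?\<psi> -` C \<inter> sphere 0 1"
      then have "z = cis (Arg2pi z)"
        using Arg2pi_eq[of z] by (simp add: cis_conv_exp)
      moreover have "Arg2pi z \<in> {0..2 * pi}"
        using Arg2pi[of z] by auto
      ultimately show "z \<in> cis ` (\<phi> -` C \<inter> {0..2 * pi})" using z by auto
    qed (use eq in auto)
    moreover have "compact (cis ` (\<phi> -` C \<inter> {0..2 * pi}))"
    proof (rule compact_continuous_image)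
      show "continuous_on (\<phi> -` C \<inter> {0..2 * pi}) cis"
        by (intro continuous_on_cis continuous_intros)
      have "closed (\<phi> -` C \<inter> {0..2 * pi})"
        using assms(1) \<open>closed C\<close> by (simp add: continuous_on_closed_vimage)
      then have "compact ({0..2 * pi} \<inter> (\<phi> -` C \<inter> {0..2 * pi}))"
        by (rule compact_Int_closed[OF compact_Icc])
      then show "compact (\<phi> -` C \<inter> {0..2 * pi})" by (simp add: Int_ac)
    qed
    ultimately show "closed (?\<psi> -` C \<inter> sphere 0 1)" by (simp add: compact_imp_closed)
  qed
qed

lemma trig_poly_uniform_approx:
  fixes \<phi> :: "real \<Rightarrow> real"
  assumes "continuous_on {0..2 * pi} \<phi>" "\<phi> 0 = \<phi> (2 * pi)" "0 < e"
  obtains T where "trig_poly T" "\<And>s. s \<in> {0..2 * pi} \<Longrightarrow> norm (of_real (\<phi> s) - T s) < e"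
proof -
  obtain \<psi> where \<psi>: "continuous_on (sphere 0 1) \<psi>" "\<And>s. s \<in> {0..2 * pi} \<Longrightarrow> \<psi> (cis s) = \<phi> s"
    using continuous_on_circle_lift[OF assms(1,2)] by blast
  obtain g where g: "real_polynomial_function g" "\<And>z. z \<in> sphere 0 1 \<Longrightarrow> \<bar>\<psi> z - g z\<bar> < e"
    using Stone_Weierstrass_real_polynomial_function[OF compact_sphere \<psi>(1) \<open>0 < e\<close>] by blast
  show ?thesis
  proof (rule that[OF trig_poly_real_polynomial[OF g(1)]])
    fix s :: real assume "s \<in> {0..2 * pi}"
    then show "norm (complex_of_real (\<phi> s) - of_real (g (cis s))) < e"
      using g(2)[of "cis s"] \<psi>(2)[of s] by (simp flip: of_real_diff)
  qed
qed

section \<open>Density of trigonometric polynomials in L2\<close>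

lemma L2_norm_le_uniform:
  fixes f :: "real \<Rightarrow> 'c::euclidean_space"
  assumes "L2_circle f" "\<And>s. s \<in> {0..2 * pi} \<Longrightarrow> norm (f s) \<le> C"
  shows "L2_norm f \<le> C * sqrt (2 * pi)"
proof -
  have C: "0 \<le> C" using assms(2)[of 0] by (auto intro: order_trans[OF norm_ge_zero])
  have "(L2_norm f)\<^sup>2 \<le> (\<integral>s. C\<^sup>2 \<partial>circle_measure)"
    unfolding L2_norm_power2
    using assms finite_measure.integrable_const[OF finite_measure_circle]
    by (intro integral_mono) (auto simp: L2_circle_def intro: power_mono)
  also have "\<dots> = (C * sqrt (2 * pi))\<^sup>2"
    by (simp add: measure_circle power_mult_distrib)
  finally show ?thesis by (rule power2_le_imp_le) (use C in auto)
qed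

lemma L2_norm_dominated_convergence:
  fixes f :: "real \<Rightarrow> 'c::euclidean_space" and g :: "nat \<Rightarrow> real \<Rightarrow> 'c"
  assumes "f \<in> borel_measurable circle_measure" "\<And>n. g n \<in> borel_measurable circle_measure"
    and "integrable circle_measure w"
    and "AE s in circle_measure. (\<lambda>n. g n s) \<longlonglongrightarrow> f s"
    and "\<And>n. AE s in circle_measure. (norm (f s - g n s))\<^sup>2 \<le> w s"
  shows "(\<lambda>n. L2_norm (\<lambda>s. f s - g n s)) \<longlonglongrightarrow> 0"
proof -
  have "(\<lambda>n. \<integral>s. (norm (f s - g n s))\<^sup>2 \<partial>circle_measure) \<longlonglongrightarrow> (\<integral>s. 0 \<partial>circle_measure)"
  proof (rule integral_dominated_convergence[OF _ _ assms(3)])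
    show "AE s in circle_measure. (\<lambda>n. (norm (f s - g n s))\<^sup>2) \<longlonglongrightarrow> 0"
      using assms(4)
    proof eventually_elim
      case (elim s)
      have "(\<lambda>n. (norm (f s - g n s))\<^sup>2) \<longlonglongrightarrow> (norm (f s - f s))\<^sup>2"
        by (intro tendsto_intros elim)
      then show ?case by simp
    qed
    show "AE s in circle_measure. norm ((norm (f s - g n s))\<^sup>2) \<le> w s" for n
      using assms(5)[of n] by eventually_elim simp
  qed (use assms in auto)
  from tendsto_real_sqrt[OF this] show ?thesis by (simp add: L2_norm_def)
qed

definition trig_approximable :: "(real \<Rightarrow> complex) \<Rightarrow> bool" where
  "trig_approximable f \<longleftrightarrow> (\<forall>e>0. \<exists>T. trig_poly T \<and> L2_norm (\<lambda>s. f s - T s) < e)"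

text \<open>This closure under L2 limits carries density from continuous to bounded and from bounded
  to square integrable functions.\<close>

lemma trig_approximable_limit:
  assumes "L2_circle f" "\<And>n::nat. L2_circle (g n)" "\<And>n. trig_approximable (g n)"
    and "(\<lambda>n. L2_norm (\<lambda>s. f s - g n s)) \<longlonglongrightarrow> 0"
  shows "trig_approximable f"
  unfolding trig_approximable_def
proof (intro allI impI)
  fix e :: real assume "0 < e"
  then have "\<forall>\<^sub>F n in sequentially. L2_norm (\<lambda>s. f s - g n s) < e / 2"
    using order_tendstoD(2)[OF assms(4), of "e / 2"] by simp
  then obtain n where n: "L2_norm (\<lambda>s. f s - g n s) < e / 2"
    by (auto simp: eventually_sequentially)
  obtain T where T: "trig_poly T" "L2_norm (\<lambda>s. g n s - T s) < e / 2"
    using assms(3)[of n] \<open>0 < e\<close> unfolding trig_approximable_def by (meson half_gt_zero)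
  have "L2_norm (\<lambda>s. f s - T s) < e"
    using L2_norm_diff_triangle[OF assms(1,2) L2_circle_trig_poly[OF T(1)], of n] n T(2) by linarith
  with T(1) show "\<exists>T. trig_poly T \<and> L2_norm (\<lambda>s. f s - T s) < e" by blast
qed

lemma trig_approximable_continuous:
  fixes \<phi> :: "real \<Rightarrow> real"
  assumes "continuous_on {0..2 * pi} \<phi>" "\<phi> 0 = \<phi> (2 * pi)"
  shows "trig_approximable (\<lambda>s. of_real (\<phi> s))"
  unfolding trig_approximable_def
proof (intro allI impI)
  fix e :: real assume "0 < e"
  define d where "d = e / (2 * sqrt (2 * pi))"
  have "0 < d" using \<open>0 < e\<close> by (simp add: d_def)
  then obtain T where T: "trig_poly T"
    "\<And>s. s \<in> {0..2 * pi} \<Longrightarrow> norm (complex_of_real (\<phi> s) - T s) < d"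
    using trig_poly_uniform_approx[OF assms] by blast
  have "L2_norm (\<lambda>s. of_real (\<phi> s) - T s) \<le> d * sqrt (2 * pi)"
    by (intro L2_norm_le_uniform L2_circle_diff L2_circle_trig_poly T L2_circle_continuous
        continuous_intros assms less_imp_le)
  also have "\<dots> < e" using \<open>0 < e\<close> by (simp add: d_def)
  finally show "\<exists>T. trig_poly T \<and> L2_norm (\<lambda>s. of_real (\<phi> s) - T s) < e"
    using T(1) by blast
qed

text \<open>A continuous function need not satisfy \<open>\<phi> 0 = \<phi> (2\<pi>)\<close>; the factor
  \<open>h n\<close> enforces it and tends to 1 away from the two end points.\<close>

lemma trig_approximable_bounded:
  fixes f :: "real \<Rightarrow> real"
  assumes f: "f \<in> borel_measurable circle_measure" and M: "\<And>s. \<bar>f s\<bar> \<le> M"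
  shows "trig_approximable (\<lambda>s. of_real (f s))"
proof -
  have "f measurable_on {0..2 * pi}"
    using f by (simp add: measurable_on_iff_borel_measurable)
  then obtain N g where N: "negligible N" and g: "\<And>n. continuous_on UNIV (g n)"
    and lim: "\<And>s. s \<notin> N \<Longrightarrow> (\<lambda>n. g n s) \<longlonglongrightarrow> (if s \<in> {0..2 * pi} then f s else 0)"
    unfolding measurable_on_def by blast
  define h where "h n s = min 1 (real n * min s (2 * pi - s))" for n s
  define u where "u n s = max (- M) (min M (g n s)) * h n s" for n s
  have M0: "0 \<le> M" using M[of 0] by linarith
  have h: "\<bar>h n s\<bar> \<le> 1" if "s \<in> {0..2 * pi}" for n s
    using that by (auto simp: h_def abs_le_iff intro: order_trans[of _ 0])
  have u_bound: "\<bar>u n s\<bar> \<le> M" if "s \<in> {0..2 * pi}" for n s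
  proof -
    have "\<bar>u n s\<bar> \<le> M * 1" unfolding u_def abs_mult
      by (intro mult_mono h that) (use M0 in auto)
    then show ?thesis by simp
  qed
  have u_cont: "continuous_on {0..2 * pi} (u n)" for n
    unfolding u_def h_def by (intro continuous_intros continuous_on_subset[OF g]) auto
  have u_ends: "u n 0 = u n (2 * pi)" for n
    by (simp add: u_def h_def)
  have u_lim: "(\<lambda>n. u n s) \<longlonglongrightarrow> f s" if "s \<in> {0..2 * pi}" "s \<notin> N" "s \<noteq> 0" "s \<noteq> 2 * pi" for s
  proof -
    have pos: "0 < min s (2 * pi - s)" using that by auto
    obtain n0 where n0: "1 < real n0 * min s (2 * pi - s)"
      using reals_Archimedean3[OF pos] by blast
    have "\<forall>\<^sub>F n in sequentially. h n s = 1"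
      unfolding eventually_sequentially
    proof (intro exI allI impI)
      fix n assume "n0 \<le> n"
      then have "real n0 * min s (2 * pi - s) \<le> real n * min s (2 * pi - s)"
        using pos by (intro mult_right_mono) auto
      with n0 show "h n s = 1" by (simp add: h_def)
    qed
    then have "(\<lambda>n. h n s) \<longlonglongrightarrow> 1" by (rule tendsto_eventually)
    moreover have "(\<lambda>n. max (- M) (min M (g n s))) \<longlonglongrightarrow> max (- M) (min M (f s))"
      using lim[OF that(2)] that(1) by (intro tendsto_intros) simp
    ultimately have "(\<lambda>n. u n s) \<longlonglongrightarrow> max (- M) (min M (f s)) * 1"
      unfolding u_def by (intro tendsto_mult)
    then show ?thesis using M[of s] by (simp add: abs_le_iff min_def max_def split: if_splits)
  qed
  have fL: "L2_circle (\<lambda>s. complex_of_real (f s))"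
    by (rule L2_circle_bounded[of _ M]) (use f M in auto)
  have uL: "L2_circle (\<lambda>s. complex_of_real (u n s))" for n
    by (intro L2_circle_continuous continuous_intros u_cont)
  show ?thesis
  proof (rule trig_approximable_limit[OF fL uL trig_approximable_continuous[OF u_cont u_ends]])
    show "(\<lambda>n. L2_norm (\<lambda>s. complex_of_real (f s) - complex_of_real (u n s))) \<longlonglongrightarrow> 0"
    proof (rule L2_norm_dominated_convergence[where w = "\<lambda>_. (2 * M)\<^sup>2"])
      have "N \<union> {0, 2 * pi} \<in> null_sets lebesgue"
        using N by (simp add: negligible_iff_null_sets[symmetric])
      then have "AE s in lebesgue. s \<notin> N \<union> {0, 2 * pi}" by (rule AE_not_in)
      then have "AE s in circle_measure. s \<notin> N \<union> {0, 2 * pi}"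
        by (subst AE_restrict_space_iff) (auto elim: eventually_mono)
      then show "AE s in circle_measure. (\<lambda>n. complex_of_real (u n s)) \<longlonglongrightarrow> complex_of_real (f s)"
        using AE_space
      proof eventually_elim
        case (elim s)
        then show ?case by (intro tendsto_of_real u_lim) auto
      qed
      show "AE s in circle_measure. (norm (complex_of_real (f s) - complex_of_real (u n s)))\<^sup>2 \<le> (2 * M)\<^sup>2" for n
      proof (rule AE_I2)
        fix s assume "s \<in> space circle_measure"
        then have "\<bar>f s - u n s\<bar> \<le> 2 * M" using M[of s] u_bound[of s n] by auto
        then show "(norm (complex_of_real (f s) - complex_of_real (u n s)))\<^sup>2 \<le> (2 * M)\<^sup>2"
          by (intro power_mono) (auto simp flip: of_real_diff)
      qed
    qed (use f fL uL finite_measure.integrable_const[OF finite_measure_circle] in \<open>auto simp: L2_circle_def\<close>)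
  qed
qed

text \<open>Truncation at height \<open>n\<close>: the error never exceeds |f|, so f^2 is an
  integrable majorant, and at a given phase \<open>s\<close> the error is 0 as soon as n \<ge> |f
  s|.\<close>

lemma trig_approximable_real:
  fixes f :: "real \<Rightarrow> real"
  assumes "L2_circle f"
  shows "trig_approximable (\<lambda>s. of_real (f s))"
proof -
  define u where "u n s = max (- real n) (min (real n) (f s))" for n s
  have f: "f \<in> borel_measurable circle_measure" "integrable circle_measure (\<lambda>s. (f s)\<^sup>2)"
    using assms by (auto simp: L2_circle_def)
  have u: "u n \<in> borel_measurable circle_measure" for n
    unfolding u_def using f(1) by measurable
  have ub: "\<bar>u n s\<bar> \<le> real n" for n s by (auto simp: u_def)
  have fu: "\<bar>f s - u n s\<bar> \<le> \<bar>f s\<bar>" for n s by (auto simp: u_def min_def max_def)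
  have fL: "L2_circle (\<lambda>s. complex_of_real (f s))"
    using f by (simp add: L2_circle_def)
  have uL: "L2_circle (\<lambda>s. complex_of_real (u n s))" for n
    by (rule L2_circle_bounded[of _ "real n"]) (use u ub in auto)
  show ?thesis
  proof (rule trig_approximable_limit[OF fL uL trig_approximable_bounded[OF u ub]])
    show "(\<lambda>n. L2_norm (\<lambda>s. complex_of_real (f s) - complex_of_real (u n s))) \<longlonglongrightarrow> 0"
    proof (rule L2_norm_dominated_convergence[OF _ _ f(2)])
      show "AE s in circle_measure. (\<lambda>n. complex_of_real (u n s)) \<longlonglongrightarrow> complex_of_real (f s)"
      proof (rule AE_I2, rule tendsto_of_real, rule tendsto_eventually)
        fix s
        obtain n0 :: nat where "\<bar>f s\<bar> \<le> real n0" using real_arch_simple by blast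
        then show "\<forall>\<^sub>F n in sequentially. u n s = f s"
          unfolding eventually_sequentially by (intro exI[of _ n0]) (auto simp: u_def)
      qed
      show "AE s in circle_measure. (norm (complex_of_real (f s) - complex_of_real (u n s)))\<^sup>2 \<le> (f s)\<^sup>2" for n
      proof (rule AE_I2)
        fix s
        have "(norm (complex_of_real (f s) - complex_of_real (u n s)))\<^sup>2 \<le> \<bar>f s\<bar>\<^sup>2"
          using fu[of s n] by (intro power_mono) (auto simp flip: of_real_diff)
        then show "(norm (complex_of_real (f s) - complex_of_real (u n s)))\<^sup>2 \<le> (f s)\<^sup>2" by simp
      qed
    qed (use fL uL in \<open>auto simp: L2_circle_def\<close>)
  qed
qed

lemma trig_approximable_L2:
  assumes "L2_circle f"
  shows "trig_approximable f"
  unfolding trig_approximable_def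
proof (intro allI impI)
  fix e :: real assume "0 < e"
  have fm: "f \<in> borel_measurable circle_measure" and fi: "integrable circle_measure (\<lambda>s. (norm (f s))\<^sup>2)"
    using assms by (auto simp: L2_circle_def)
  have R: "L2_circle (\<lambda>s. Re (f s))" "L2_circle (\<lambda>s. Im (f s))"
    by (rule L2_circle_dominated[OF _ fi]; use fm in \<open>simp add: cmod_power2\<close>)+
  then have RC: "L2_circle (\<lambda>s. complex_of_real (Re (f s)))" "L2_circle (\<lambda>s. complex_of_real (Im (f s)))"
    by (auto simp: L2_circle_def intro: measurable_compose[OF _ borel_measurable_of_real])
  obtain T where T: "trig_poly T" "L2_norm (\<lambda>s. of_real (Re (f s)) - T s) < e / 2"
    using trig_approximable_real[OF R(1)] \<open>0 < e\<close> unfolding trig_approximable_def by (meson half_gt_zero)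
  obtain U where U: "trig_poly U" "L2_norm (\<lambda>s. of_real (Im (f s)) - U s) < e / 2"
    using trig_approximable_real[OF R(2)] \<open>0 < e\<close> unfolding trig_approximable_def by (meson half_gt_zero)
  have "trig_poly (\<lambda>s. T s + \<i> * U s)"
    by (intro trig_poly.add trig_poly_mult trig_poly_const T U)
  moreover have "L2_norm (\<lambda>s. f s - (T s + \<i> * U s)) < e"
  proof -
    let ?p = "\<lambda>s. of_real (Re (f s)) - T s" and ?q = "\<lambda>s. \<i> * (of_real (Im (f s)) - U s)"
    have eq: "(\<lambda>s. f s - (T s + \<i> * U s)) = (\<lambda>s. ?p s + ?q s)"
      by (rule ext, subst complex_eq[of "f _"]) (simp add: algebra_simps)
    have "L2_norm (\<lambda>s. ?p s + ?q s) \<le> L2_norm ?p + L2_norm ?q"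
    proof (rule L2_norm_triangle)
      show "L2_circle ?p" by (intro L2_circle_diff RC L2_circle_trig_poly T)
      have "L2_circle (\<lambda>s. of_real (Im (f s)) - U s)" by (intro L2_circle_diff RC L2_circle_trig_poly U)
      then show "L2_circle ?q" by (auto simp: L2_circle_def norm_mult)
    qed
    moreover have "L2_norm ?q = L2_norm (\<lambda>s. of_real (Im (f s)) - U s)"
      by (simp add: L2_norm_def norm_mult)
    ultimately show ?thesis unfolding eq using T(2) U(2) by linarith
  qed
  ultimately show "\<exists>T. trig_poly T \<and> L2_norm (\<lambda>s. f s - T s) < e" by blast
qed

text \<open>One approximant per \<open>e\<close> suffices: if its frequencies lie in
  \<open>K0\<close>, the Fourier sum over every finite superset of \<open>K0\<close> is at least as
  close to \<open>f\<close>.\<close>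

lemma L2_norm_fourier_tendsto:
  assumes "L2_circle f"
  shows "((\<lambda>K. L2_norm (\<lambda>s. f s - (\<Sum>k\<in>K. fourier_coeff f k * fourier_char k s))) \<longlongrightarrow> 0)
    (finite_subsets_at_top UNIV)"
proof (rule tendstoI)
  fix e :: real assume "0 < e"
  then obtain T where T: "trig_poly T" "L2_norm (\<lambda>s. f s - T s) < e"
    using trig_approximable_L2[OF assms] unfolding trig_approximable_def by blast
  obtain K0 p where K0: "finite K0" "T = (\<lambda>s. \<Sum>k\<in>K0. p k * fourier_char k s)"
    using trig_poly_eq_sum[OF T(1)] by blast
  have lt: "L2_norm (\<lambda>s. f s - (\<Sum>k\<in>K. fourier_coeff f k * fourier_char k s)) < e"
    if "finite K" "K0 \<subseteq> K" for K
    using L2_norm_fourier_best[OF assms that, of p] T(2) K0(2) by simp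
  show "\<forall>\<^sub>F K in finite_subsets_at_top UNIV.
      dist (L2_norm (\<lambda>s. f s - (\<Sum>k\<in>K. fourier_coeff f k * fourier_char k s))) 0 < e"
    unfolding eventually_finite_subsets_at_top
    by (intro exI[of _ K0]) (use K0(1) lt in auto)
qed

section \<open>Fourier series of vector-valued functions\<close>

lemma L2_norm_vec_power2:
  fixes f :: "real \<Rightarrow> complex^'q"
  assumes "L2_circle f"
  shows "(L2_norm f)\<^sup>2 = (\<Sum>i\<in>UNIV. (L2_norm (\<lambda>s. f s $ i))\<^sup>2)"
    and "L2_circle (\<lambda>s. f s $ i)"
proof -
  show comp: "L2_circle (\<lambda>s. f s $ i)" for i
  proof (rule L2_circle_dominated)
    show "integrable circle_measure (\<lambda>s. (norm (f s))\<^sup>2)"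
      using assms by (simp add: L2_circle_def)
    show "(\<lambda>s. f s $ i) \<in> borel_measurable circle_measure"
      using assms borel_measurable_continuous_onI[OF continuous_on_component[OF continuous_on_id], of i]
      by (auto simp: L2_circle_def intro: measurable_compose)
  qed (intro power_mono Finite_Cartesian_Product.norm_nth_le norm_ge_zero)
  have "(norm v)\<^sup>2 = (\<Sum>i\<in>UNIV. (norm (v $ i))\<^sup>2)" for v :: "complex^'q"
    by (simp add: norm_vec_def L2_set_def sum_nonneg)
  then show "(L2_norm f)\<^sup>2 = (\<Sum>i\<in>UNIV. (L2_norm (\<lambda>s. f s $ i))\<^sup>2)"
    unfolding L2_norm_power2 using comp
    by (simp add: L2_circle_def)
qed

lemma L2_circle_fourier_term: "L2_circle (\<lambda>s. fourier_char k s *s (a :: complex^'q))"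
  unfolding vector_scalar_mult_def by (intro L2_circle_continuous continuous_intros)

text \<open>Both claims reduce to components, whose squared norms add up. The bound by
  \<open>L2_norm c\<close>, uniform in \<open>K\<close>, is Bessel's inequality; it controls
  arbitrary incomplete Fourier sums in the double series.\<close>

theorem fourier_series_vec:
  fixes c :: "real \<Rightarrow> complex^'q"
  assumes "L2_circle c"
  defines "a \<equiv> \<lambda>k. \<chi> i. fourier_coeff (\<lambda>s. c s $ i) k"
  shows "L2_has_sum (\<lambda>k s. fourier_char k s *s a k) c UNIV"
    and "finite K \<Longrightarrow> L2_norm (\<lambda>s. \<Sum>k\<in>K. fourier_char k s *s a k) \<le> L2_norm c"
proof -
  let ?S = "\<lambda>K s. \<Sum>k\<in>K. fourier_char k s *s a k"
  have SL: "L2_circle (?S K)" for K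
    by (intro L2_circle_sum L2_circle_fourier_term)
  have S: "?S K s $ i = (\<Sum>k\<in>K. fourier_coeff (\<lambda>s. c s $ i) k * fourier_char k s)" for K s i
    by (simp add: a_def mult.commute)
  have ci: "L2_circle (\<lambda>s. c s $ i)" for i by (rule L2_norm_vec_power2(2)[OF assms(1)])
  {
    assume "finite K"
    have "(L2_norm (?S K))\<^sup>2 \<le> (L2_norm c)\<^sup>2"
      unfolding L2_norm_vec_power2(1)[OF SL] L2_norm_vec_power2(1)[OF assms(1)] S
      by (intro sum_mono L2_norm_bessel ci \<open>finite K\<close>)
    then show "L2_norm (?S K) \<le> L2_norm c" by (rule power2_le_imp_le) simp
  }
  have "((\<lambda>K. (\<Sum>i\<in>UNIV. (L2_norm (\<lambda>s. c s $ i - ?S K s $ i))\<^sup>2)) \<longlongrightarrow> (\<Sum>i\<in>(UNIV::'q set). 0\<^sup>2))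
     (finite_subsets_at_top UNIV)"
    unfolding S by (intro tendsto_sum tendsto_power L2_norm_fourier_tendsto ci)
  moreover have "(\<Sum>i\<in>UNIV. (L2_norm (\<lambda>s. c s $ i - ?S K s $ i))\<^sup>2) = (L2_norm (\<lambda>s. c s - ?S K s))\<^sup>2" for K
    using L2_norm_vec_power2(1)[OF L2_circle_diff[OF assms(1) SL], of K] by simp
  ultimately have "((\<lambda>K. (L2_norm (\<lambda>s. c s - ?S K s))\<^sup>2) \<longlongrightarrow> 0) (finite_subsets_at_top UNIV)"
    by simp
  from tendsto_real_sqrt[OF this]
  show "L2_has_sum (\<lambda>k s. fourier_char k s *s a k) c UNIV"
    unfolding L2_has_sum_def using assms(1) by (simp add: L2_circle_fourier_term)
qed

section \<open>Substituting a linear map into a power series\<close>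

abbreviation mdeg :: "('n::finite \<Rightarrow> nat) \<Rightarrow> nat" where
  "mdeg m \<equiv> \<Sum>i\<in>UNIV. m i"

lemma multiindices_subset_PiE: "{m :: 'n::finite \<Rightarrow> nat. mdeg m \<le> N} \<subseteq> (\<Pi>\<^sub>E i\<in>UNIV. {..N})"
proof
  fix m :: "'n \<Rightarrow> nat" assume m: "m \<in> {m. mdeg m \<le> N}"
  have "m i \<le> mdeg m" for i by (rule member_le_sum) auto
  with m show "m \<in> (\<Pi>\<^sub>E i\<in>UNIV. {..N})" by (auto intro: order_trans)
qed

lemma finite_multiindices_le: "finite {m :: 'n::finite \<Rightarrow> nat. mdeg m \<le> N}"
  by (rule finite_subset[OF multiindices_subset_PiE]) (simp add: finite_PiE)

lemma finite_multiindices_eq: "finite {m :: 'n::finite \<Rightarrow> nat. mdeg m = N}"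
  by (rule finite_subset[OF _ finite_multiindices_le[of N]]) auto

lemma finite_subset_multiindices_le:
  fixes F :: "('n::finite \<Rightarrow> nat) set"
  assumes "finite F"
  obtains N where "F \<subseteq> {m. mdeg m \<le> N}"
proof
  show "F \<subseteq> {m. mdeg m \<le> (\<Sum>m\<in>F. mdeg m)}"
    using assms by (auto intro: member_le_sum[where f = mdeg])
qed

text \<open>Every finite set of multi-indices has bounded degree, so the degree truncations are
  cofinal. Hence an unconditional sum is also the limit of the sums taken by degree.\<close>

lemma filterlim_multiindices_le:
  "filterlim (\<lambda>N. {m :: 'n::finite \<Rightarrow> nat. mdeg m \<le> N}) (finite_subsets_at_top UNIV) sequentially"
  unfolding filterlim_iff eventually_finite_subsets_at_top
proof (intro allI impI)
  fix Q :: "('n \<Rightarrow> nat) set \<Rightarrow> bool"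
  assume "\<exists>X. finite X \<and> X \<subseteq> UNIV \<and> (\<forall>Y. finite Y \<and> X \<subseteq> Y \<and> Y \<subseteq> UNIV \<longrightarrow> Q Y)"
  then obtain X where X: "finite X" "\<And>Y. finite Y \<Longrightarrow> X \<subseteq> Y \<Longrightarrow> Q Y" by auto
  obtain N0 where "X \<subseteq> {m. mdeg m \<le> N0}" using finite_subset_multiindices_le[OF X(1)] .
  then have "Q {m. mdeg m \<le> N}" if "N0 \<le> N" for N
    using that by (intro X(2) finite_multiindices_le) auto
  then show "\<forall>\<^sub>F N in sequentially. Q {m. mdeg m \<le> N}"
    unfolding eventually_sequentially by blast
qed

text \<open>Having equal degree is symmetric, so truncating either index at \<open>N\<close> selects
  the same pairs. This is why a linear substitution, which preserves degree, commutes with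
  truncation.\<close>

lemma sum_swap_multiindices:
  fixes f :: "('n::finite \<Rightarrow> nat) \<Rightarrow> ('n \<Rightarrow> nat) \<Rightarrow> 'a::comm_monoid_add"
  shows "(\<Sum>m | mdeg m \<le> N. \<Sum>m' | mdeg m' = mdeg m. f m m')
    = (\<Sum>m' | mdeg m' \<le> N. \<Sum>m | mdeg m = mdeg m'. f m m')"
proof -
  let ?A = "{m :: 'n \<Rightarrow> nat. mdeg m \<le> N}"
  have "(\<Sum>m\<in>?A. \<Sum>m' | mdeg m' = mdeg m. f m m') = (\<Sum>m\<in>?A. \<Sum>m' | m' \<in> ?A \<and> mdeg m' = mdeg m. f m m')"
    by (intro sum.cong refl) auto
  also have "\<dots> = (\<Sum>m'\<in>?A. \<Sum>m | m \<in> ?A \<and> mdeg m' = mdeg m. f m m')"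
    by (rule sum.swap_restrict) (rule finite_multiindices_le)+
  also have "\<dots> = (\<Sum>m'\<in>?A. \<Sum>m | mdeg m = mdeg m'. f m m')"
    by (intro sum.cong refl) auto
  finally show ?thesis .
qed

text \<open>The simplex of multi-indices lies in a box, over which the sum factors into one-variable
  geometric sums.\<close>

lemma sum_geometric_multiindices_le:
  fixes \<theta> :: real
  assumes "0 \<le> \<theta>" "\<theta> < 1"
  shows "(\<Sum>m :: 'n::finite \<Rightarrow> nat | mdeg m \<le> N. \<theta> ^ mdeg m) \<le> (1 / (1 - \<theta>)) ^ CARD('n)"
proof -
  have "(\<Sum>m :: 'n \<Rightarrow> nat | mdeg m \<le> N. \<theta> ^ mdeg m) \<le> (\<Sum>m\<in>(\<Pi>\<^sub>E i\<in>(UNIV::'n set). {..N}). \<theta> ^ mdeg m)"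
    using assms by (intro sum_mono2 multiindices_subset_PiE) (auto simp: finite_PiE)
  also have "\<dots> = (\<Sum>m\<in>(\<Pi>\<^sub>E i\<in>(UNIV::'n set). {..N}). \<Prod>i\<in>UNIV. \<theta> ^ m i)"
    by (simp add: power_sum)
  also have "\<dots> = (\<Prod>i\<in>(UNIV::'n set). \<Sum>k\<le>N. \<theta> ^ k)"
    by (rule prod_sum_PiE[symmetric]) auto
  also have "\<dots> \<le> (\<Prod>i\<in>(UNIV::'n set). 1 / (1 - \<theta>))"
  proof (intro prod_mono conjI)
    have "(\<Sum>k\<le>N. \<theta> ^ k) \<le> suminf (\<lambda>k. \<theta> ^ k)"
      using assms by (intro sum_le_suminf summable_geometric) auto
    then show "(\<Sum>k\<le>N. \<theta> ^ k) \<le> 1 / (1 - \<theta>)"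
      using assms by (simp add: suminf_geometric)
  qed (use assms in \<open>auto intro: sum_nonneg\<close>)
  finally show ?thesis by simp
qed

text \<open>A Cauchy majorant argument. \<open>\<kappa> m' m\<close> stands for the size of the
  coefficient of z^m in (Q z)^m', \<open>\<beta>\<close> for the sizes of the old and
  \<open>\<gamma>\<close> for those of the new coefficients. The index m' contributes at most
  \<beta> m' (L x)^|m'| \<le> C \<theta>^|m'| with \<theta> = L x / t < 1. The sizes are plain
  reals, so that they may be values at one phase or L2 norms.\<close>

lemma summable_on_power_series_substitution:
  fixes \<kappa> :: "('n::finite \<Rightarrow> nat) \<Rightarrow> ('n \<Rightarrow> nat) \<Rightarrow> real"
  assumes \<kappa>: "\<And>m m'. 0 \<le> \<kappa> m' m" "\<And>m'. (\<Sum>m | mdeg m = mdeg m'. \<kappa> m' m) \<le> L ^ mdeg m'"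
    and \<beta>: "\<And>m. 0 \<le> \<beta> m" "\<And>m. \<beta> m * t ^ mdeg m \<le> C"
    and \<gamma>: "\<And>m. 0 \<le> \<gamma> m" "\<And>m. \<gamma> m \<le> (\<Sum>m' | mdeg m' = mdeg m. \<kappa> m' m * \<beta> m')"
    and x: "0 \<le> L" "0 \<le> x" "L * x < t"
  shows "(\<lambda>m. \<gamma> m * x ^ mdeg m) summable_on UNIV"
proof (rule nonneg_bdd_above_summable_on)
  show "0 \<le> \<gamma> m * x ^ mdeg m" for m using \<gamma>(1) x by simp
  have t: "0 < t" using x by (meson le_less_trans mult_nonneg_nonneg)
  have C: "0 \<le> C" using \<beta>[of "\<lambda>_. 0"] by simp
  define \<theta> where "\<theta> = L * x / t"
  have \<theta>: "0 \<le> \<theta>" "\<theta> < 1" using x t by (auto simp: \<theta>_def)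
  have "sum (\<lambda>m. \<gamma> m * x ^ mdeg m) F \<le> C * (1 / (1 - \<theta>)) ^ CARD('n)" if F: "finite F" for F
  proof -
    obtain N where N: "F \<subseteq> {m. mdeg m \<le> N}" using finite_subset_multiindices_le[OF F] .
    have "sum (\<lambda>m. \<gamma> m * x ^ mdeg m) F \<le> (\<Sum>m | mdeg m \<le> N. \<gamma> m * x ^ mdeg m)"
      using \<gamma>(1) x by (intro sum_mono2 N finite_multiindices_le) simp
    also have "\<dots> \<le> (\<Sum>m | mdeg m \<le> N. (\<Sum>m' | mdeg m' = mdeg m. \<kappa> m' m * \<beta> m') * x ^ mdeg m)"
      using x by (intro sum_mono mult_right_mono \<gamma>) auto
    also have "\<dots> = (\<Sum>m | mdeg m \<le> N. \<Sum>m' | mdeg m' = mdeg m. \<kappa> m' m * \<beta> m' * x ^ mdeg m')"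
      by (simp add: sum_distrib_right)
    also have "\<dots> = (\<Sum>m' | mdeg m' \<le> N. \<Sum>m | mdeg m = mdeg m'. \<kappa> m' m * \<beta> m' * x ^ mdeg m')"
      by (rule sum_swap_multiindices)
    also have "\<dots> \<le> (\<Sum>m' :: 'n \<Rightarrow> nat | mdeg m' \<le> N. C * \<theta> ^ mdeg m')"
    proof (rule sum_mono)
      fix m' :: "'n \<Rightarrow> nat"
      have "(\<Sum>m | mdeg m = mdeg m'. \<kappa> m' m * \<beta> m' * x ^ mdeg m')
         = (\<Sum>m | mdeg m = mdeg m'. \<kappa> m' m) * (\<beta> m' * x ^ mdeg m')"
        by (simp add: sum_distrib_right mult.assoc)
      also have "\<dots> \<le> L ^ mdeg m' * (\<beta> m' * x ^ mdeg m')"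
        using x \<beta>(1) by (intro mult_right_mono \<kappa>) auto
      also have "\<dots> = (\<beta> m' * t ^ mdeg m') * \<theta> ^ mdeg m'"
        using t by (simp add: \<theta>_def power_divide power_mult_distrib)
      also have "\<dots> \<le> C * \<theta> ^ mdeg m'"
        using \<theta> by (intro mult_right_mono \<beta>) auto
      finally show "(\<Sum>m | mdeg m = mdeg m'. \<kappa> m' m * \<beta> m' * x ^ mdeg m') \<le> C * \<theta> ^ mdeg m'" .
    qed
    also have "\<dots> \<le> C * (1 / (1 - \<theta>)) ^ CARD('n)"
      unfolding sum_distrib_left[symmetric]
      by (intro mult_left_mono sum_geometric_multiindices_le \<theta> C)
    finally show ?thesis .
  qed
  then show "bdd_above (sum (\<lambda>m. \<gamma> m * x ^ mdeg m) ` {F. F \<subseteq> UNIV \<and> finite F})"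
    by (intro bdd_aboveI2) auto
qed

section \<open>Monomials and homogeneous forms with majorised coefficients\<close>

lemma mpow_zero: "mpow x (\<lambda>_. 0) = 1"
  by (simp add: mpow_def)

lemma mpow_add: "mpow x (\<lambda>i. m i + m' i) = mpow x m * mpow x m'"
  by (simp add: mpow_def power_add prod.distrib)

lemma mpow_unit: "mpow x (\<lambda>i. if i = j then 1 else 0) = x $ j"
proof -
  have "mpow x (\<lambda>i. if i = j then 1 else 0) = (\<Prod>i\<in>UNIV. if i = j then x $ i else 1)"
    unfolding mpow_def by (rule prod.cong) auto
  then show ?thesis by simp
qed

lemma mpow_const: "mpow (\<chi> i. t) m = t ^ mdeg m"
  by (simp add: mpow_def power_sum)

lemma norm_mpow_le:
  fixes z :: "('a::{real_normed_field})^'n"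
  assumes "\<And>i. norm (z $ i) \<le> r"
  shows "norm (mpow z m) \<le> r ^ mdeg m"
proof -
  have "norm (mpow z m) = (\<Prod>i\<in>UNIV. norm (z $ i) ^ m i)"
    by (simp add: mpow_def prod_norm[symmetric] norm_power)
  also have "\<dots> \<le> (\<Prod>i\<in>UNIV. r ^ m i)"
    by (intro prod_mono conjI power_mono assms) auto
  finally show ?thesis by (simp add: power_sum)
qed

text \<open>\<open>\<kappa>\<close> bounds each coefficient uniformly in \<open>s\<close>, and
  \<open>\<beta>\<close> bounds the total: an l1 norm of the coefficients. That norm is
  submultiplicative, so \<open>\<beta>\<close> follows products and powers of forms.\<close>

definition bounded_form ::
    "'x::topological_space set \<Rightarrow> nat \<Rightarrow> ('x \<Rightarrow> complex^'n \<Rightarrow> complex) \<Rightarrow> real \<Rightarrow> bool" where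
  "bounded_form X d p \<beta> \<longleftrightarrow> (\<exists>K \<kappa>.
     (\<forall>m. continuous_on X (K m)) \<and> (\<forall>m. \<forall>s\<in>X. norm (K m s) \<le> \<kappa> m) \<and> (\<forall>m. 0 \<le> \<kappa> m) \<and>
     (\<Sum>m | mdeg m = d. \<kappa> m) \<le> \<beta> \<and>
     (\<forall>s\<in>X. \<forall>z. p s z = (\<Sum>m | mdeg m = d. K m s * mpow z m)))"

lemma bounded_form_one: "bounded_form X 0 (\<lambda>_ _ :: complex^'n. 1) 1"
  unfolding bounded_form_def
proof (intro exI conjI allI ballI)
  have "{m :: 'n \<Rightarrow> nat. mdeg m = 0} = {\<lambda>_. 0}" by auto
  then show "(\<Sum>m :: 'n \<Rightarrow> nat | mdeg m = 0. 1) \<le> (1::real)"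
    and "1 = (\<Sum>m | mdeg m = 0. 1 * mpow z m)" for z :: "complex^'n"
    by (simp_all add: mpow_zero)
qed auto

lemma bounded_form_linear:
  fixes q :: "'x::topological_space \<Rightarrow> 'n::finite \<Rightarrow> complex"
  assumes "\<And>j. continuous_on X (\<lambda>s. q s j)" "\<And>s j. s \<in> X \<Longrightarrow> norm (q s j) \<le> r" "0 \<le> r"
  shows "bounded_form X 1 (\<lambda>s z. \<Sum>j\<in>UNIV. q s j * z $ j) (real CARD('n) * r)"
proof -
  define u :: "'n \<Rightarrow> 'n \<Rightarrow> nat" where "u j = (\<lambda>i. if i = j then 1 else 0)" for j
  let ?D = "{m :: 'n \<Rightarrow> nat. mdeg m = 1}"
  have uD: "u j \<in> ?D" for j by (simp add: u_def)
  \<comment> \<open>The multi-indices of degree 1 are the unit vectors \<open>u j\<close>.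
    Coefficients written as a sum over the cases \<open>m = u j\<close> let sums over
    \<open>m\<close> collapse to sums over \<open>j\<close>; \<open>pick\<close> is used for both
    the coefficients and their bounds.\<close>
  have pick: "(\<Sum>m\<in>?D. (\<Sum>j\<in>UNIV. if m = u j then g j else 0) * h m) = (\<Sum>j\<in>UNIV. g j * h (u j))"
    for g :: "'n \<Rightarrow> 'a::comm_semiring_1" and h
  proof -
    have "(\<Sum>m\<in>?D. (\<Sum>j\<in>UNIV. if m = u j then g j else 0) * h m) 
       = (\<Sum>j\<in>UNIV. \<Sum>m\<in>?D. if m = u j then g j * h m else 0)"
      unfolding sum_distrib_right by (subst sum.swap) (intro sum.cong refl, auto)
    also have "\<dots> = (\<Sum>j\<in>UNIV. g j * h (u j))"
      using uD by (intro sum.cong refl) (simp add: sum.delta[OF finite_multiindices_eq])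
    finally show ?thesis .
  qed
  show ?thesis
    unfolding bounded_form_def
  proof (intro exI conjI allI ballI)
    fix m :: "'n \<Rightarrow> nat"
    show "continuous_on X (\<lambda>s. \<Sum>j\<in>UNIV. if m = u j then q s j else 0)"
    proof (intro continuous_on_sum)
      show "continuous_on X (\<lambda>s. if m = u j then q s j else 0)" for j
        by (cases "m = u j") (simp_all add: assms)
    qed
    show "norm (\<Sum>j\<in>UNIV. if m = u j then q s j else 0) \<le> (\<Sum>j\<in>UNIV. if m = u j then r else 0)"
      if "s \<in> X" for s
      by (rule sum_norm_le) (use assms(2)[OF that] in auto)
    show "0 \<le> (\<Sum>j\<in>UNIV. if m = u j then r else 0)"
      using assms(3) by (auto intro: sum_nonneg)
  next
    show "(\<Sum>m\<in>?D. \<Sum>j\<in>UNIV. if m = u j then r else 0) \<le> real CARD('n) * r"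
      using pick[of "\<lambda>_. r" "\<lambda>_. 1"] by simp
    show "(\<Sum>j\<in>UNIV. q s j * z $ j) = (\<Sum>m\<in>?D. (\<Sum>j\<in>UNIV. if m = u j then q s j else 0) * mpow z m)" for s z
      unfolding pick by (simp add: u_def mpow_unit)
  qed
qed

text \<open>Cauchy product: the coefficient at \<open>m\<close> collects the pairs of multi-indices
  that add up to \<open>m\<close>. Summing over all these fibres gives the sum over all pairs, so
  the two bounds multiply.\<close>

lemma bounded_form_mult:
  fixes p1 p2 :: "'x::topological_space \<Rightarrow> complex^'n \<Rightarrow> complex"
  assumes "bounded_form X d1 p1 \<beta>1" "bounded_form X d2 p2 \<beta>2" "0 \<le> \<beta>1"
  shows "bounded_form X (d1 + d2) (\<lambda>s z. p1 s z * p2 s z) (\<beta>1 * \<beta>2)"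
proof -
  obtain K1 \<kappa>1 where 1: "\<And>m. continuous_on X (K1 m)" "\<And>m s. s \<in> X \<Longrightarrow> norm (K1 m s) \<le> \<kappa>1 m"
    "\<And>m. 0 \<le> \<kappa>1 m" "(\<Sum>m | mdeg m = d1. \<kappa>1 m) \<le> \<beta>1"
    "\<And>s z. s \<in> X \<Longrightarrow> p1 s z = (\<Sum>m | mdeg m = d1. K1 m s * mpow z m)"
    using assms(1) unfolding bounded_form_def by blast
  obtain K2 \<kappa>2 where 2: "\<And>m. continuous_on X (K2 m)" "\<And>m s. s \<in> X \<Longrightarrow> norm (K2 m s) \<le> \<kappa>2 m"
    "\<And>m. 0 \<le> \<kappa>2 m" "(\<Sum>m | mdeg m = d2. \<kappa>2 m) \<le> \<beta>2"
    "\<And>s z. s \<in> X \<Longrightarrow> p2 s z = (\<Sum>m | mdeg m = d2. K2 m s * mpow z m)"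
    using assms(2) unfolding bounded_form_def by blast
  define D where "D = {m :: 'n \<Rightarrow> nat. mdeg m = d1} \<times> {m :: 'n \<Rightarrow> nat. mdeg m = d2}"
  define ad :: "('n \<Rightarrow> nat) \<times> ('n \<Rightarrow> nat) \<Rightarrow> 'n \<Rightarrow> nat" where "ad = (\<lambda>(a, b) i. a i + b i)"
  have finD: "finite D" by (simp add: D_def finite_multiindices_eq)
  have adD: "ad ` D \<subseteq> {m. mdeg m = d1 + d2}"
    by (auto simp: D_def ad_def sum.distrib)
  note group = sum.group[OF finD finite_multiindices_eq adD]
  show ?thesis
    unfolding bounded_form_def
  proof (intro exI conjI allI ballI)
    fix m
    show "continuous_on X (\<lambda>s. \<Sum>ab\<in>{ab \<in> D. ad ab = m}. K1 (fst ab) s * K2 (snd ab) s)"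
      by (intro continuous_intros 1 2)
    show "norm (\<Sum>ab\<in>{ab \<in> D. ad ab = m}. K1 (fst ab) s * K2 (snd ab) s)
        \<le> (\<Sum>ab\<in>{ab \<in> D. ad ab = m}. \<kappa>1 (fst ab) * \<kappa>2 (snd ab))" if "s \<in> X" for s
      by (intro sum_norm_le) (simp add: norm_mult mult_mono 1 2 that)
    show "0 \<le> (\<Sum>ab\<in>{ab \<in> D. ad ab = m}. \<kappa>1 (fst ab) * \<kappa>2 (snd ab))"
      by (intro sum_nonneg mult_nonneg_nonneg 1 2)
  next
    have "(\<Sum>m | mdeg m = d1 + d2. \<Sum>ab\<in>{ab \<in> D. ad ab = m}. \<kappa>1 (fst ab) * \<kappa>2 (snd ab))
       = (\<Sum>ab\<in>D. \<kappa>1 (fst ab) * \<kappa>2 (snd ab))"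
      by (rule group)
    also have "\<dots> = (\<Sum>m | mdeg m = d1. \<kappa>1 m) * (\<Sum>m | mdeg m = d2. \<kappa>2 m)"
      by (simp add: D_def sum_product sum.cartesian_product case_prod_beta)
    also have "\<dots> \<le> \<beta>1 * \<beta>2"
      by (intro mult_mono 1 2 sum_nonneg assms)
    finally show "(\<Sum>m | mdeg m = d1 + d2. \<Sum>ab\<in>{ab \<in> D. ad ab = m}. \<kappa>1 (fst ab) * \<kappa>2 (snd ab)) \<le> \<beta>1 * \<beta>2" .
  next
    fix s z assume s: "s \<in> X"
    have "(\<Sum>m | mdeg m = d1 + d2. (\<Sum>ab\<in>{ab \<in> D. ad ab = m}. K1 (fst ab) s * K2 (snd ab) s) * mpow z m)
       = (\<Sum>m | mdeg m = d1 + d2. \<Sum>ab\<in>{ab \<in> D. ad ab = m}. K1 (fst ab) s * K2 (snd ab) s * mpow z (ad ab))"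
      by (simp add: sum_distrib_right)
    also have "\<dots> = (\<Sum>ab\<in>D. K1 (fst ab) s * K2 (snd ab) s * mpow z (ad ab))"
      by (rule group)
    also have "\<dots> = p1 s z * p2 s z"
      unfolding 1(5)[OF s] 2(5)[OF s]
      by (simp add: D_def ad_def sum_product sum.cartesian_product case_prod_beta mpow_add mult_ac)
    finally show "p1 s z * p2 s z
       = (\<Sum>m | mdeg m = d1 + d2. (\<Sum>ab\<in>{ab \<in> D. ad ab = m}. K1 (fst ab) s * K2 (snd ab) s) * mpow z m)"
      by (rule sym)
  qed
qed

lemma bounded_form_power:
  assumes "bounded_form X d p \<beta>" "0 \<le> \<beta>"
  shows "bounded_form X (k * d) (\<lambda>s z. p s z ^ k) (\<beta> ^ k)"
proof (induction k)
  case 0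
  show ?case using bounded_form_one by simp
next
  case (Suc k)
  show ?case using bounded_form_mult[OF assms(1) Suc assms(2)] by simp
qed

lemma bounded_form_prod:
  assumes "finite I" "\<And>i. i \<in> I \<Longrightarrow> bounded_form X (d i) (p i) (\<beta> i)" "\<And>i. i \<in> I \<Longrightarrow> 0 \<le> \<beta> i"
  shows "bounded_form X (\<Sum>i\<in>I. d i) (\<lambda>s z. \<Prod>i\<in>I. p i s z) (\<Prod>i\<in>I. \<beta> i)"
  using assms
proof (induction I rule: finite_induct)
  case empty
  show ?case using bounded_form_one by simp
next
  case (insert i I)
  then show ?case using bounded_form_mult[of X "d i" "p i" "\<beta> i"] by simp
qed

text \<open>Each coordinate of Q z is a linear form with \<open>CARD('n)\<close> coefficients of
  size at most \<open>r\<close>, and the monomial multiplies |m| such forms.\<close>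

lemma bounded_form_mpow:
  fixes Q :: "'x::topological_space \<Rightarrow> complex^'n^'n"
  assumes "\<And>i j. continuous_on X (\<lambda>s. Q s $ i $ j)"
    and "\<And>s i j. s \<in> X \<Longrightarrow> norm (Q s $ i $ j) \<le> r" "0 \<le> r"
  shows "bounded_form X (mdeg m) (\<lambda>s z. mpow (Q s *v z) m) ((real CARD('n) * r) ^ mdeg m)"
proof -
  have "bounded_form X (\<Sum>i\<in>UNIV. m i * 1) (\<lambda>s z. \<Prod>i\<in>UNIV. (\<Sum>j\<in>UNIV. Q s $ i $ j * z $ j) ^ m i)
      (\<Prod>i\<in>UNIV. (real CARD('n) * r) ^ m i)"
    by (intro bounded_form_prod bounded_form_power bounded_form_linear mult_nonneg_nonneg zero_le_power assms) auto
  then show ?thesis by (simp add: mpow_def matrix_vector_mult_def power_sum)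
qed

section \<open>Floquet coordinates\<close>

lemma matrix_inv_inverse:
  assumes "invertible (A :: 'a::semiring_1^'n^'m)"
  shows "A ** matrix_inv A = mat 1" "matrix_inv A ** A = mat 1"
  using someI_ex[OF assms[unfolded invertible_def]] by (auto simp: matrix_inv_def)

lemma invertible_matrix_inv: "invertible A \<Longrightarrow> invertible (matrix_inv A)"
  unfolding invertible_def[of "matrix_inv A"] by (intro exI[of _ A] conjI matrix_inv_inverse)

abbreviation complex_vec :: "real^'n \<Rightarrow> complex^'n" where
  "complex_vec y \<equiv> \<chi> i. of_real (y $ i)"

lemma bounded_linear_complex_vec: "bounded_linear (complex_vec :: real^'n \<Rightarrow> complex^'n)"
  unfolding linear_conv_bounded_linear[symmetric]
  by (rule linearI) (auto simp: vec_eq_iff scaleR_conv_of_real[symmetric])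

lemma complex_vec_mult: "complex_vec (A *v y) = map_matrix of_real A *v complex_vec y"
  by (simp add: vec_eq_iff matrix_vector_mult_def map_matrix_def)

lemma mpow_complex_vec: "mpow (complex_vec y) m = of_real (mpow y m)"
  by (simp add: mpow_def)

lemma bounded_linear_vector_scalar_mult_left: "bounded_linear (\<lambda>c :: complex. c *s (v :: complex^'n))"
  unfolding linear_conv_bounded_linear[symmetric]
  by (rule linearI) (auto simp: vec_eq_iff algebra_simps)

lemma has_vector_derivative_exp_of_real:
  fixes c :: complex
  shows
  "((\<lambda>t. exp (c * of_real t)) has_vector_derivative c * exp (c * of_real t)) (at t)"
  by (rule has_vector_derivative_real_field[of "\<lambda>z. exp (c * z)"]) (auto intro!: derivative_eq_intros)

lemma diagonal_mult_vec: "(\<chi> i j. if i = j then \<mu> $ i else 0) *v x = (\<chi> i. \<mu> $ i * x $ i)"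
  by (simp add: vec_eq_iff matrix_vector_mult_def if_distrib if_distribR cong: if_cong)

text \<open>Floquet's theorem provides \<open>P\<close> only through the correspondence of solutions; continuity
  is read off the solutions \<open>exp (\<mu> $ j * t) *s (column j of V)\<close>.\<close>

lemma floquet_form_continuous:
  fixes P :: "real \<Rightarrow> complex^'n^'n" and V :: "complex^'n^'n"
  assumes "floquet_form A P B" "invertible V"
    and diag: "matrix_inv V ** B ** V = (\<chi> i j. if i = j then \<mu> $ i else 0)"
  shows "continuous_on UNIV (\<lambda>s. (P s ** V) $ i $ j)"
proof -
  define e :: "complex^'n" where "e = axis j 1"
  define w where "w t = exp (\<mu> $ j * of_real t) *s (V *v e)" for t
  have "B *v (V *v e) = V *v ((matrix_inv V ** B ** V) *v e)"
    by (simp add: matrix_vector_mul_assoc matrix_mul_assoc matrix_inv_inverse[OF assms(2)])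
  also have "\<dots> = V *v (\<mu> $ j *s e)"
    unfolding diag diagonal_mult_vec by (rule arg_cong[of _ _ "(*v) V"]) (auto simp: e_def vec_eq_iff axis_def)
  finally have eig: "B *v (V *v e) = \<mu> $ j *s (V *v e)"
    by (simp add: vector_scalar_commute)
  have "(w has_vector_derivative B *v w t) (at t)" for t
  proof -
    have "(w has_vector_derivative (\<mu> $ j * exp (\<mu> $ j * of_real t)) *s (V *v e)) (at t)"
      unfolding w_def
      by (rule bounded_linear.has_vector_derivative[OF bounded_linear_vector_scalar_mult_left
            has_vector_derivative_exp_of_real])
    moreover have "B *v w t = (\<mu> $ j * exp (\<mu> $ j * of_real t)) *s (V *v e)"
      unfolding w_def by (simp add: vector_scalar_commute eig mult.commute)
    ultimately show ?thesis by simp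
  qed
  \<comment> \<open>The phase line starting at 0 meets every phase, and of the image solution only
    its continuity is kept.\<close>
  then have "\<forall>t. ((\<lambda>t. P (0 + t) *v w t) has_vector_derivative
      map_matrix of_real (A (0 + t)) *v (P (0 + t) *v w t)) (at t)"
    using assms(1) unfolding floquet_form_def by blast
  then have "continuous_on UNIV (\<lambda>t. P t *v w t)"
    by (intro continuous_on_vector_derivative) auto
  then have "continuous_on UNIV (\<lambda>t. exp (- \<mu> $ j * of_real t) * (P t *v w t) $ i)"
    by (intro continuous_intros)
  moreover have "exp (- \<mu> $ j * of_real t) * (P t *v w t) $ i = (P t ** V) $ i $ j" for t
  proof -
    have "P t *v w t = exp (\<mu> $ j * of_real t) *s ((P t ** V) *v e)"
      by (simp add: w_def vector_scalar_commute matrix_vector_mul_assoc)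
    moreover have "((P t ** V) *v e) $ i = (P t ** V) $ i $ j"
      by (simp add: e_def matrix_vector_mult_def axis_def if_distrib cong: if_cong)
    ultimately show ?thesis
      by (simp flip: mult.assoc exp_add)
  qed
  ultimately show ?thesis by simp
qed

lemma floquet_coord_inverse:
  assumes "invertible (P s)" "invertible V"
  shows "(P s ** V) *v floquet_coord P V y s = complex_vec y"
proof -
  have "(P s ** V) *v floquet_coord P V y s
     = (P s ** (V ** matrix_inv V) ** matrix_inv (P s)) *v complex_vec y"
    by (simp add: floquet_coord_def matrix_vector_mul_assoc matrix_mul_assoc)
  then show ?thesis by (simp add: matrix_inv_inverse assms)
qed

section \<open>Continuity and non-vanishing of the Floquet coordinates\<close>

lemma continuous_on_det [continuous_intros]:
  fixes A :: "'x::topological_space \<Rightarrow> complex^'n^'n"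
  assumes "\<And>i j. continuous_on X (\<lambda>s. A s $ i $ j)"
  shows "continuous_on X (\<lambda>s. det (A s))"
  unfolding det_def by (intro continuous_intros assms)

text \<open>Cramer's rule: each coordinate of the solution is a quotient of determinants with
  continuous entries and nonvanishing denominator. With Q = P V it yields the continuity of the
  Floquet coordinates in the phase.\<close>

lemma continuous_on_linear_system:
  fixes Q :: "'x::topological_space \<Rightarrow> complex^'n^'n"
  assumes Q: "\<And>i j. continuous_on X (\<lambda>s. Q s $ i $ j)" "\<And>s. s \<in> X \<Longrightarrow> invertible (Q s)"
    and z: "\<And>s. s \<in> X \<Longrightarrow> Q s *v z s = b"
  shows "continuous_on X (\<lambda>s. z s $ k)"
proof -
  have d: "det (Q s) \<noteq> 0" if "s \<in> X" for s
    using Q(2)[OF that] by (simp add: invertible_det_nz)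
  have "continuous_on X (\<lambda>s. det (\<chi> i j. if j = k then b $ i else Q s $ i $ j) / det (Q s))"
  proof (rule continuous_on_divide[OF continuous_on_det continuous_on_det[OF Q(1)]])
    show "continuous_on X (\<lambda>s. (\<chi> i j. if j = k then b $ i else Q s $ i $ j) $ i' $ j')" for i' j'
      by (cases "j' = k") (simp_all add: Q)
  qed (use d in blast)
  moreover have "z s $ k = det (\<chi> i j. if j = k then b $ i else Q s $ i $ j) / det (Q s)" if "s \<in> X" for s
    using z[OF that] unfolding cramer[OF d[OF that]] by simp
  ultimately show ?thesis by (simp cong: continuous_on_cong)
qed

text \<open>On the moment curve y = (1, t, t^2, ...), in some ordering of the coordinates, each
  coordinate of M y is a polynomial in \<open>t\<close>, and not the zero polynomial because an
  invertible matrix has no zero row. The finitely many rows exclude finitely many \<open>t\<close>.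
  The point obtained shows that no monomial in \<open>z\<close> is the zero function.\<close>

lemma complex_vec_avoids_rows:
  fixes M :: "complex^'n^'n"
  assumes "invertible M"
  obtains y where "\<And>i. (M *v complex_vec y) $ i \<noteq> 0"
proof -
  obtain \<sigma> :: "'n \<Rightarrow> nat" where \<sigma>: "bij_betw \<sigma> UNIV {0..<CARD('n)}"
    using ex_bij_betw_finite_nat[of "UNIV :: 'n set"] by auto
  define \<tau> where "\<tau> = the_inv_into UNIV \<sigma>"
  have \<tau>\<sigma>: "\<tau> (\<sigma> j) = j" for j
    unfolding \<tau>_def using \<sigma> by (intro the_inv_into_f_f) (auto simp: bij_betw_def)
  define Z where "Z i = {z. (\<Sum>k\<le>CARD('n) - 1. M $ i $ \<tau> k * z ^ k) = 0}" for i
  have Zfin: "finite (Z i)" for i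
  proof -
    have "\<exists>j. M $ i $ j \<noteq> 0"
    proof (rule ccontr)
      assume "\<not> ?thesis"
      then have "(M ** matrix_inv M) $ i $ i = 0" by (simp add: matrix_matrix_mult_def)
      then show False by (simp add: matrix_inv_inverse assms mat_def)
    qed
    then obtain j where "M $ i $ j \<noteq> 0" ..
    moreover have "\<sigma> j \<in> {0..<CARD('n)}" using \<sigma> by (auto simp: bij_betw_def)
    ultimately have "\<sigma> j \<le> CARD('n) - 1 \<and> M $ i $ \<tau> (\<sigma> j) \<noteq> 0" by (auto simp: \<tau>\<sigma>)
    then show ?thesis unfolding Z_def polyfun_finite_roots by blast
  qed
  have "finite (complex_of_real -` (\<Union>i. Z i))"
    by (intro finite_vimageI) (auto simp: Zfin inj_on_def)
  then obtain t :: real where t: "t \<notin> complex_of_real -` (\<Union>i. Z i)"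
    using ex_new_if_finite infinite_UNIV_char_0 by blast
  show ?thesis
  proof
    fix i
    have "(M *v complex_vec (\<chi> j. t ^ \<sigma> j)) $ i = (\<Sum>j\<in>UNIV. M $ i $ \<tau> (\<sigma> j) * of_real t ^ \<sigma> j)"
      by (simp add: matrix_vector_mult_def \<tau>\<sigma>)
    also have "\<dots> = (\<Sum>k\<in>{0..<CARD('n)}. M $ i $ \<tau> k * of_real t ^ k)"
      by (rule sum.reindex_bij_betw[OF \<sigma>])
    \<comment> \<open>The polynomial in \<open>Z\<close> is summed up to its top exponent
      inclusively; the subtraction is harmless because \<open>CARD('n)\<close> is positive.\<close>
    also have "{0..<CARD('n)} = {..CARD('n) - 1}"
      by (simp add: atLeast0LessThan lessThan_Suc_atMost[symmetric])
    finally show "(M *v complex_vec (\<chi> j. t ^ \<sigma> j)) $ i \<noteq> 0"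
      using t by (auto simp: Z_def)
  qed
qed

section \<open>Evolution of the Floquet coordinates along the flow\<close>

lemma flow_skew_field:
  assumes "flow_of (skew_field A) S"
  shows "((\<lambda>t. fst (S t (y, s))) has_vector_derivative A (s + t) *v fst (S t (y, s))) (at t)"
    and "snd (S t (y, s)) = s + t"
proof -
  have S0: "S 0 (y, s) = (y, s)"
    and S: "((\<lambda>t. S t (y, s)) has_vector_derivative skew_field A (S t (y, s))) (at t)" for t
    using assms by (auto simp: flow_of_def)
  \<comment> \<open>The phase minus time is constant, so the phase is s + t, which turns the first
    component into a solution along the phase line through \<open>s\<close>.\<close>
  have "((\<lambda>t. snd (S t (y, s)) - t) has_vector_derivative 0) (at t)" for t
    using bounded_linear.has_vector_derivative[OF bounded_linear_snd S[of t]]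
    by (auto intro!: derivative_eq_intros simp: skew_field_def split: prod.splits)
  then obtain c where "\<And>t. snd (S t (y, s)) - t = c"
    using has_vector_derivative_zero_constant[OF convex_UNIV, of "\<lambda>t. snd (S t (y, s)) - t"] by auto
  from this[of 0] this have snd: "snd (S t (y, s)) = s + t" for t
    by (metis S0 diff_add_cancel diff_zero snd_conv)
  show "snd (S t (y, s)) = s + t" by (rule snd)
  show "((\<lambda>t. fst (S t (y, s))) has_vector_derivative A (s + t) *v fst (S t (y, s))) (at t)"
    using bounded_linear.has_vector_derivative[OF bounded_linear_fst S[of t]]
    unfolding skew_field_def snd[symmetric] by (simp add: case_prod_beta)
qed

text \<open>The correspondence of solutions, read from \<open>y\<close> back to \<open>w\<close>,
  gives w' = B w, and \<open>V\<close> decouples this into scalar equations. Multiplied by the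
  integrating factor exp(-\<mu>_i t), the coordinate z_i has zero derivative and is therefore
  constant.\<close>

lemma floquet_coord_flow:
  fixes P :: "real \<Rightarrow> complex^'n^'n"
  assumes flow: "flow_of (skew_field A) S" and P: "floquet_form A P B" and V: "invertible V"
    and diag: "matrix_inv V ** B ** V = (\<chi> i j. if i = j then \<mu> $ i else 0)"
  shows "floquet_coord P V (fst (S t (y, s))) (s + t) $ i
    = exp (\<mu> $ i * of_real t) * floquet_coord P V y s $ i"
proof -
  define Y where "Y t = fst (S t (y, s))" for t
  define w where "w t = matrix_inv (P (s + t)) *v complex_vec (Y t)" for t
  define z where "z t = matrix_inv V *v w t" for t
  have Pw: "P (s + t) *v w t = complex_vec (Y t)" for t
    using P by (simp add: w_def matrix_vector_mul_assoc floquet_form_def matrix_inv_inverse)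
  have "((\<lambda>t. complex_vec (Y t)) has_vector_derivative
      map_matrix of_real (A (s + t)) *v complex_vec (Y t)) (at t)" for t
    using bounded_linear.has_vector_derivative[OF bounded_linear_complex_vec flow_skew_field(1)[OF flow]]
    unfolding complex_vec_mult Y_def .
  then have "(w has_vector_derivative B *v w t) (at t)" for t
    using P unfolding floquet_form_def Pw[symmetric] by blast
  then have z: "(z has_vector_derivative matrix_inv V *v (B *v w t)) (at t)" for t
    unfolding z_def by (rule bounded_linear.has_vector_derivative[OF matrix_vector_mul_bounded_linear])
  have "matrix_inv V *v (B *v w t) = (matrix_inv V ** B ** V) *v z t" for t
    by (simp add: z_def matrix_vector_mul_assoc matrix_mul_assoc[symmetric] matrix_inv_inverse[OF V])
  then have z_deriv: "((\<lambda>t. z t $ i) has_vector_derivative \<mu> $ i * z t $ i) (at t)" for t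
    using bounded_linear.has_vector_derivative[OF bounded_linear_vec_nth z[of t], of i]
    unfolding diag diagonal_mult_vec by simp
  have "((\<lambda>t. exp (- \<mu> $ i * of_real t) * z t $ i) has_vector_derivative 0) (at t)" for t
    using has_vector_derivative_mult[OF has_vector_derivative_exp_of_real[of "- \<mu> $ i" t] z_deriv[of t]]
    by (simp add: algebra_simps)
  then obtain c where c: "\<And>t. exp (- \<mu> $ i * of_real t) * z t $ i = c"
    using has_vector_derivative_zero_constant[OF convex_UNIV, of "\<lambda>t. exp (- \<mu> $ i * of_real t) * z t $ i"]
    by auto
  have "exp (\<mu> $ i * of_real t) * (exp (- \<mu> $ i * of_real t) * z t $ i) = exp (\<mu> $ i * of_real t) * z 0 $ i"
    using c[of t] c[of 0] by simp
  then have "z t $ i = exp (\<mu> $ i * of_real t) * z 0 $ i"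
    by (simp flip: mult.assoc exp_add)
  moreover have "S 0 (y, s) = (y, s)" using flow by (simp add: flow_of_def)
  ultimately show ?thesis
    by (simp add: z_def w_def Y_def floquet_coord_def)
qed

lemma koopman_eigenfunction_mpow:
  fixes P :: "real \<Rightarrow> complex^'n^'n"
  assumes flow: "flow_of (skew_field A) S" and P: "floquet_form A P B" and V: "invertible V"
    and diag: "matrix_inv V ** B ** V = (\<chi> i j. if i = j then \<mu> $ i else 0)"
  shows "koopman_eigenfunction S ((\<Sum>i\<in>UNIV. of_nat (m i) * \<mu> $ i) + \<i> * of_int k)
    (\<lambda>(y, s). mpow (floquet_coord P V y s) m * fourier_char k s)"
  unfolding koopman_eigenfunction_def
proof (intro conjI allI)
  show "circle_periodic (\<lambda>(y, s). mpow (floquet_coord P V y s) m * fourier_char k s)"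
    using P by (simp add: circle_periodic_def floquet_form_def floquet_coord_def fourier_char_periodic)
  \<comment> \<open>A single real point at phase 0 where all coordinates of \<open>z\<close> are
    nonzero rules out the zero function for every \<open>m\<close> and \<open>k\<close>.\<close>
  have "invertible (matrix_inv V ** matrix_inv (P 0))"
    using P V unfolding floquet_form_def by (intro invertible_mult invertible_matrix_inv) auto
  then obtain y where "\<And>i. floquet_coord P V y 0 $ i \<noteq> 0"
    using complex_vec_avoids_rows[of "matrix_inv V ** matrix_inv (P 0)"]
    by (auto simp: floquet_coord_def matrix_vector_mul_assoc)
  then have "mpow (floquet_coord P V y 0) m * fourier_char k 0 \<noteq> 0"
    by (simp add: mpow_def fourier_char_def)
  then show "\<exists>x. (case x of (y, s) \<Rightarrow> mpow (floquet_coord P V y s) m * fourier_char k s) \<noteq> 0"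
    by (intro exI[of _ "(y, 0)"]) simp
  fix t
  show "koopman S t (\<lambda>(y, s). mpow (floquet_coord P V y s) m * fourier_char k s) =
      (\<lambda>x. exp (((\<Sum>i\<in>UNIV. of_nat (m i) * \<mu> $ i) + \<i> * of_int k) * of_real t) *
        (case x of (y, s) \<Rightarrow> mpow (floquet_coord P V y s) m * fourier_char k s))"
  proof (rule ext, clarify)
    fix y s
    have S: "S t (y, s) = (fst (S t (y, s)), s + t)"
      using flow_skew_field(2)[OF flow, of t y s] by (metis prod.collapse)
    have "mpow (floquet_coord P V (fst (S t (y, s))) (s + t)) m
       = (\<Prod>i\<in>UNIV. exp (\<mu> $ i * of_real t) ^ m i) * mpow (floquet_coord P V y s) m"
      by (simp add: mpow_def floquet_coord_flow[OF assms] power_mult_distrib prod.distrib)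
    also have "(\<Prod>i\<in>UNIV. exp (\<mu> $ i * of_real t) ^ m i) = exp ((\<Sum>i\<in>UNIV. of_nat (m i) * \<mu> $ i) * of_real t)"
      by (simp add: exp_sum sum_distrib_right exp_of_nat_mult[symmetric] mult.assoc)
    finally have 1: "mpow (floquet_coord P V (fst (S t (y, s))) (s + t)) m
       = exp ((\<Sum>i\<in>UNIV. of_nat (m i) * \<mu> $ i) * of_real t) * mpow (floquet_coord P V y s) m" .
    have 2: "fourier_char k (s + t) = exp (\<i> * of_int k * of_real t) * fourier_char k s"
      by (simp add: fourier_char_def exp_add[symmetric] algebra_simps)
    show "koopman S t (\<lambda>(y, s). mpow (floquet_coord P V y s) m * fourier_char k s) (y, s) =
      exp (((\<Sum>i\<in>UNIV. of_nat (m i) * \<mu> $ i) + \<i> * of_int k) * of_real t) *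
        (mpow (floquet_coord P V y s) m * fourier_char k s)"
      unfolding koopman_def o_apply by (subst S) (simp add: 1 2 distrib_right exp_add)
  qed
qed

section \<open>Double series\<close>

text \<open>Close to the limit, one more index moves a finite sum by at most 2, which bounds every
  term outside \<open>F0\<close>; the others are bounded by their sum over \<open>F0\<close>. This
  is the source of the coefficient estimates for the power series.\<close>

lemma has_sum_bounded_terms:
  fixes f :: "'i \<Rightarrow> 'a::real_normed_vector"
  assumes "(f has_sum g) UNIV"
  obtains C where "\<And>i. norm (f i) \<le> C"
proof -
  have "\<forall>\<^sub>F F in finite_subsets_at_top UNIV. dist (sum f F) g < 1"
    using assms by (intro tendstoD) (auto simp: has_sum_def)
  then obtain F0 where F0: "finite F0" "\<And>F. finite F \<Longrightarrow> F0 \<subseteq> F \<Longrightarrow> dist (sum f F) g < 1"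
    unfolding eventually_finite_subsets_at_top by auto
  show ?thesis
  proof
    fix i
    show "norm (f i) \<le> 2 + (\<Sum>j\<in>F0. norm (f j))"
    proof (cases "i \<in> F0")
      case True
      then have "norm (f i) \<le> (\<Sum>j\<in>F0. norm (f j))" using F0(1) by (intro member_le_sum) auto
      then show ?thesis by simp
    next
      case False
      have "f i = sum f (insert i F0) - sum f F0" using False F0(1) by simp
      then have "norm (f i) \<le> dist (sum f (insert i F0)) g + dist (sum f F0) g"
        by (metis dist_norm dist_triangle2)
      also have "\<dots> \<le> 2"
        using F0(2)[of F0] F0(2)[of "insert i F0", OF _ subset_insertI] F0(1) by auto
      finally show ?thesis by (simp add: sum_nonneg add_increasing2)
    qed
  qed
qed

text \<open>The one-more-index argument for partial sums in the L2 norm; it bounds the norms of the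
  coefficients instead of their values at a phase.\<close>

lemma L2_has_sum_bounded_terms:
  fixes f :: "'i \<Rightarrow> real \<Rightarrow> 'c::euclidean_space"
  assumes "L2_has_sum f g UNIV"
  obtains C where "\<And>i. L2_norm (f i) \<le> C"
proof -
  have L: "L2_circle (f i)" "L2_circle g" for i using assms by (auto simp: L2_has_sum_def)
  have LS: "L2_circle (\<lambda>s. \<Sum>i\<in>F. f i s)" for F by (intro L2_circle_sum L)
  have "\<forall>\<^sub>F F in finite_subsets_at_top UNIV. dist (L2_norm (\<lambda>s. g s - (\<Sum>i\<in>F. f i s))) 0 < 1"
    using assms by (intro tendstoD) (auto simp: L2_has_sum_def)
  then obtain F0 where F0: "finite F0"
    "\<And>F. finite F \<Longrightarrow> F0 \<subseteq> F \<Longrightarrow> L2_norm (\<lambda>s. g s - (\<Sum>i\<in>F. f i s)) < 1"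
    unfolding eventually_finite_subsets_at_top by auto
  show ?thesis
  proof
    fix i
    show "L2_norm (f i) \<le> 2 + (\<Sum>j\<in>F0. L2_norm (f j))"
    proof (cases "i \<in> F0")
      case True
      then have "L2_norm (f i) \<le> (\<Sum>j\<in>F0. L2_norm (f j))" using F0(1) by (intro member_le_sum) auto
      then show ?thesis by simp
    next
      case False
      have "f i = (\<lambda>s. (\<Sum>j\<in>insert i F0. f j s) - (\<Sum>j\<in>F0. f j s))" using False F0(1) by simp
      then have "L2_norm (f i) \<le> L2_norm (\<lambda>s. (\<Sum>j\<in>insert i F0. f j s) - g s) + L2_norm (\<lambda>s. g s - (\<Sum>j\<in>F0. f j s))"
        using L2_norm_diff_triangle[OF LS[of "insert i F0"] L(2) LS[of F0]] by metis
      also have "\<dots> \<le> 2"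
        using F0(2)[of F0] F0(2)[of "insert i F0", OF _ subset_insertI] F0(1)
          L2_norm_minus_commute[of "\<lambda>s. \<Sum>j\<in>insert i F0. f j s" g] by auto
      finally show ?thesis by (simp add: sum_nonneg add_increasing2)
    qed
  qed
qed

text \<open>A finite set of pairs is cut into slices over \<open>m\<close>. Over \<open>E N\<close>
  the slices contain enough frequencies to be close to \<open>c m\<close>. Elsewhere they are
  arbitrary, and the uniform bound on partial sums estimates them by
  \<open>M m * L2_norm (c m)\<close>, a tail of a convergent series. Since \<open>E\<close> is
  cofinal, \<open>E N\<close> eventually contains a finite set that carries nearly all of that
  series.\<close>

lemma L2_has_sum_double:
  fixes u :: "'m \<Rightarrow> real \<Rightarrow> complex" and c :: "'m \<Rightarrow> real \<Rightarrow> complex^'q"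
    and f :: "'m \<Rightarrow> 'k \<Rightarrow> real \<Rightarrow> complex^'q"
  assumes u: "\<And>m. u m \<in> borel_measurable circle_measure"
      "\<And>m s. s \<in> {0..2 * pi} \<Longrightarrow> norm (u m s) \<le> M m"
    and f: "\<And>m. L2_has_sum (f m) (c m) UNIV"
      "\<And>m K. finite K \<Longrightarrow> L2_norm (\<lambda>s. \<Sum>k\<in>K. f m k s) \<le> L2_norm (c m)"
    and w: "(\<lambda>m. M m * L2_norm (c m)) summable_on UNIV"
    and E: "filterlim E (finite_subsets_at_top UNIV) sequentially"
    and G: "L2_circle G" "(\<lambda>N. L2_norm (\<lambda>s. G s - (\<Sum>m\<in>E N. u m s *s c m s))) \<longlonglongrightarrow> 0"
  shows "L2_has_sum (\<lambda>(m, k) s. u m s *s f m k s) G UNIV"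
proof -
  have M: "0 \<le> M m" for m using u(2)[of 0 m] by (auto intro: order_trans[OF norm_ge_zero])
  have cL: "L2_circle (c m)" and fL: "L2_circle (f m k)" for m k
    using f(1)[of m] by (auto simp: L2_has_sum_def)
  note scale = L2_circle_scale[OF u(1) _ u(2)]
  have "\<exists>J0. finite J0 \<and> (\<forall>J. finite J \<and> J0 \<subseteq> J \<longrightarrow>
      L2_norm (\<lambda>s. G s - (\<Sum>(m, k)\<in>J. u m s *s f m k s)) < e)" if "0 < e" for e :: real
  proof -
    obtain F0 where F0: "finite F0"
      "dist (sum (\<lambda>m. M m * L2_norm (c m)) F0) (\<Sum>\<^sub>\<infinity>m. M m * L2_norm (c m)) \<le> e / 6"
      using has_sum_finite_approximation[OF has_sum_infsum[OF w], of "e / 6"] \<open>0 < e\<close> by auto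
    \<comment> \<open>\<open>F0\<close> misses at most e/6 of the total weight; as the terms are
      nonnegative, no finite set disjoint from \<open>F0\<close> can weigh more.\<close>
    have tail: "(\<Sum>m\<in>F. M m * L2_norm (c m)) \<le> e / 6" if F: "finite F" "F \<inter> F0 = {}" for F
    proof -
      have "(\<Sum>m\<in>F \<union> F0. M m * L2_norm (c m)) \<le> (\<Sum>\<^sub>\<infinity>m. M m * L2_norm (c m))"
        using F F0 M by (intro finite_sum_le_infsum w) auto
      moreover have "(\<Sum>m\<in>F \<union> F0. M m * L2_norm (c m)) 
          = (\<Sum>m\<in>F. M m * L2_norm (c m)) + (\<Sum>m\<in>F0. M m * L2_norm (c m))"
        using F F0 by (intro sum.union_disjoint) auto
      ultimately show ?thesis using F0(2) unfolding dist_real_def by linarith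
    qed
    have "\<forall>\<^sub>F F in finite_subsets_at_top UNIV. finite F \<and> F0 \<subseteq> F"
      using F0(1) unfolding eventually_finite_subsets_at_top by (intro exI[of _ F0]) simp
    from eventually_compose_filterlim[OF this E]
    have "\<forall>\<^sub>F N in sequentially. finite (E N) \<and> F0 \<subseteq> E N" .
    moreover have "\<forall>\<^sub>F N in sequentially. L2_norm (\<lambda>s. G s - (\<Sum>m\<in>E N. u m s *s c m s)) < e / 3"
      using order_tendstoD(2)[OF G(2), of "e / 3"] \<open>0 < e\<close> by simp
    ultimately have "\<forall>\<^sub>F N in sequentially. (finite (E N) \<and> F0 \<subseteq> E N) \<and>
        L2_norm (\<lambda>s. G s - (\<Sum>m\<in>E N. u m s *s c m s)) < e / 3"
      by (rule eventually_conj)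
    then obtain N where N: "finite (E N)" "F0 \<subseteq> E N"
        "L2_norm (\<lambda>s. G s - (\<Sum>m\<in>E N. u m s *s c m s)) < e / 3"
      by (auto simp: eventually_sequentially)
    \<comment> \<open>The budget e/3 is shared among the members of \<open>E N\<close>. The 1 added
      to the cardinality makes the total strictly less than e/3, the 1 added to \<open>M m\<close>
      keeps the divisor positive.\<close>
    define \<epsilon> where "\<epsilon> m = e / (3 * (real (card (E N)) + 1) * (M m + 1))" for m
    have \<epsilon>: "0 < \<epsilon> m" for m
      using \<open>0 < e\<close> M[of m] unfolding \<epsilon>_def by (intro divide_pos_pos mult_pos_pos) auto
    have M\<epsilon>: "M m * \<epsilon> m \<le> e / (3 * (real (card (E N)) + 1))" for m
    proof -
      have "M m * \<epsilon> m \<le> (M m + 1) * \<epsilon> m" using \<epsilon>[of m] by (simp add: mult_right_mono)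
      also have "\<dots> = e / (3 * (real (card (E N)) + 1))"
        using M[of m] by (simp add: \<epsilon>_def)
      finally show ?thesis .
    qed
    have "\<exists>K0. finite K0 \<and> (\<forall>K. finite K \<and> K0 \<subseteq> K \<longrightarrow> L2_norm (\<lambda>s. c m s - (\<Sum>k\<in>K. f m k s)) < \<epsilon> m)" for m
    proof -
      have "\<forall>\<^sub>F K in finite_subsets_at_top UNIV. dist (L2_norm (\<lambda>s. c m s - (\<Sum>k\<in>K. f m k s))) 0 < \<epsilon> m"
        using f(1)[of m] \<epsilon> by (intro tendstoD) (auto simp: L2_has_sum_def)
      then show ?thesis by (auto simp: eventually_finite_subsets_at_top)
    qed
    then obtain K0 where K0: "\<And>m. finite (K0 m)"
        "\<And>m K. finite K \<Longrightarrow> K0 m \<subseteq> K \<Longrightarrow> L2_norm (\<lambda>s. c m s - (\<Sum>k\<in>K. f m k s)) < \<epsilon> m"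
      by metis
    show ?thesis
    proof (intro exI[of _ "Sigma (E N) K0"] conjI allI impI)
      show "finite (Sigma (E N) K0)" using N(1) K0(1) by auto
      fix J assume J: "finite J \<and> Sigma (E N) K0 \<subseteq> J"
      define T where "T m = {k. (m, k) \<in> J}" for m
      define D where "D = fst ` J - E N"
      have Tfin: "finite (T m)" for m
        by (rule finite_subset[of _ "snd ` J"]) (use J in \<open>force simp: T_def\<close>)+
      have TK: "K0 m \<subseteq> T m" if "m \<in> E N" for m using J that by (auto simp: T_def)
      have Dfin: "finite D" "D \<inter> F0 = {}" "E N \<inter> D = {}" using J N(2) by (auto simp: D_def)
      have JS: "J = Sigma (E N \<union> D) T" by (force simp: D_def T_def)
      define p where "p m s = u m s *s (c m s - (\<Sum>k\<in>T m. f m k s))" for m s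
      define r where "r m s = u m s *s (\<Sum>k\<in>T m. f m k s)" for m s
      have "(\<Sum>(m, k)\<in>J. u m s *s f m k s) = (\<Sum>m\<in>E N \<union> D. r m s)" for s
        unfolding JS r_def using Tfin N(1) Dfin
        by (subst sum.Sigma[symmetric]) (auto simp: vec.scale_sum_right)
      also have "(\<Sum>m\<in>E N \<union> D. r m s) = (\<Sum>m\<in>E N. r m s) + (\<Sum>m\<in>D. r m s)" for s
        using N(1) Dfin by (intro sum.union_disjoint) auto
      \<comment> \<open>Three errors: truncation of the \<open>m\<close>-series to
        \<open>E N\<close> (below e/3), incomplete slices over \<open>E N\<close> (below e/3), and
        the surplus indices \<open>D\<close> (at most e/6).\<close>
      finally have split: "(\<lambda>s. G s - (\<Sum>(m, k)\<in>J. u m s *s f m k s))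
         = (\<lambda>s. (G s - (\<Sum>m\<in>E N. u m s *s c m s)) + ((\<Sum>m\<in>E N. p m s) - (\<Sum>m\<in>D. r m s)))"
        by (simp add: p_def r_def vec.scale_right_diff_distrib sum_subtractf algebra_simps)
      have L1: "L2_circle (\<lambda>s. c m s - (\<Sum>k\<in>T m. f m k s))" and L2: "L2_circle (\<lambda>s. \<Sum>k\<in>T m. f m k s)" for m
        by (intro L2_circle_diff L2_circle_sum cL fL)+
      have pL: "L2_circle (p m)" "L2_norm (p m) \<le> M m * L2_norm (\<lambda>s. c m s - (\<Sum>k\<in>T m. f m k s))" for m
        unfolding p_def by (rule scale[OF L1]; assumption)+
      have rL: "L2_circle (r m)" "L2_norm (r m) \<le> M m * L2_norm (\<lambda>s. \<Sum>k\<in>T m. f m k s)" for m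
        unfolding r_def by (rule scale[OF L2]; assumption)+
      have "L2_norm (\<lambda>s. \<Sum>m\<in>E N. p m s) \<le> (\<Sum>m\<in>E N. L2_norm (p m))"
        by (intro L2_norm_sum pL)
      also have "\<dots> \<le> (\<Sum>m\<in>E N. e / (3 * (real (card (E N)) + 1)))"
      proof (rule sum_mono)
        fix m assume "m \<in> E N"
        then have "L2_norm (\<lambda>s. c m s - (\<Sum>k\<in>T m. f m k s)) \<le> \<epsilon> m"
          using K0(2)[OF Tfin TK] by (simp add: less_imp_le)
        then have "L2_norm (p m) \<le> M m * \<epsilon> m"
          using pL(2)[of m] mult_left_mono[OF _ M[of m]] by (meson order_trans)
        then show "L2_norm (p m) \<le> e / (3 * (real (card (E N)) + 1))" using M\<epsilon>[of m] by linarith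
      qed
      also have "\<dots> < e / 3"
        using \<open>0 < e\<close> by (simp add: field_simps)
      finally have P: "L2_norm (\<lambda>s. \<Sum>m\<in>E N. p m s) < e / 3" .
      have "L2_norm (\<lambda>s. \<Sum>m\<in>D. r m s) \<le> (\<Sum>m\<in>D. L2_norm (r m))"
        by (intro L2_norm_sum rL)
      also have "\<dots> \<le> (\<Sum>m\<in>D. M m * L2_norm (c m))"
        using f(2)[OF Tfin] M by (intro sum_mono order_trans[OF rL(2)] mult_left_mono)
      also have "\<dots> \<le> e / 6" by (rule tail[OF Dfin(1,2)])
      finally have R: "L2_norm (\<lambda>s. \<Sum>m\<in>D. r m s) \<le> e / 6" .
      have LP: "L2_circle (\<lambda>s. \<Sum>m\<in>E N. p m s)" and LR: "L2_circle (\<lambda>s. \<Sum>m\<in>D. r m s)"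
        by (intro L2_circle_sum pL rL)+
      have LG: "L2_circle (\<lambda>s. G s - (\<Sum>m\<in>E N. u m s *s c m s))"
        by (intro L2_circle_diff G L2_circle_sum scale(1) cL)
      have "L2_norm (\<lambda>s. (\<Sum>m\<in>E N. p m s) - (\<Sum>m\<in>D. r m s))
          \<le> L2_norm (\<lambda>s. \<Sum>m\<in>E N. p m s) + L2_norm (\<lambda>s. \<Sum>m\<in>D. r m s)"
        using L2_norm_triangle[OF LP L2_circle_minus[OF LR]] by (simp add: L2_norm_def)
      then show "L2_norm (\<lambda>s. G s - (\<Sum>(m, k)\<in>J. u m s *s f m k s)) < e"
        unfolding split using L2_norm_triangle[OF LG L2_circle_diff[OF LP LR]] N(3) P R \<open>0 < e\<close>
        by linarith
    qed
  qed
  then have "((\<lambda>J. L2_norm (\<lambda>s. G s - (\<Sum>(m, k)\<in>J. u m s *s f m k s))) \<longlongrightarrow> 0) (finite_subsets_at_top UNIV)"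
    by (intro tendstoI) (simp add: eventually_finite_subsets_at_top)
  then show ?thesis
    unfolding L2_has_sum_def by (auto simp: case_prod_beta G(1) intro: scale(1) fL)
qed

text \<open>Since a linear substitution preserves degree, the new coefficient at \<open>m\<close> is
  a finite combination of the \<open>b m'\<close> with |m'| = |m|, and truncations by degree agree
  exactly for every \<open>N\<close>. One majorant \<open>\<kappa>\<close> serves both the values at
  a phase and the L2 norms.\<close>

lemma power_series_linear_substitution:
  fixes Q :: "real \<Rightarrow> complex^'n^'n" and b :: "('n \<Rightarrow> nat) \<Rightarrow> real \<Rightarrow> complex^'q"
  assumes Q: "\<And>i j. continuous_on {0..2 * pi} (\<lambda>s. Q s $ i $ j)"
      "\<And>s i j. s \<in> {0..2 * pi} \<Longrightarrow> norm (Q s $ i $ j) \<le> r" "0 \<le> r"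
    and b: "\<And>m. L2_circle (b m)"
  obtains c \<kappa> where "\<And>m. L2_circle (c m)"
    and "\<And>s z N. s \<in> {0..2 * pi} \<Longrightarrow>
      (\<Sum>m | mdeg m \<le> N. mpow z m *s c m s) = (\<Sum>m | mdeg m \<le> N. mpow (Q s *v z) m *s b m s)"
    and "\<And>m m'. 0 \<le> \<kappa> m' m" and "\<And>m'. (\<Sum>m | mdeg m = mdeg m'. \<kappa> m' m) \<le> (real CARD('n) * r) ^ mdeg m'"
    and "\<And>m s. s \<in> {0..2 * pi} \<Longrightarrow> norm (c m s) \<le> (\<Sum>m' | mdeg m' = mdeg m. \<kappa> m' m * norm (b m' s))"
    and "\<And>m. L2_norm (c m) \<le> (\<Sum>m' | mdeg m' = mdeg m. \<kappa> m' m * L2_norm (b m'))"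
proof -
  have "\<forall>m'. \<exists>K \<kappa>. (\<forall>m. continuous_on {0..2 * pi} (K m)) \<and> (\<forall>m. \<forall>s\<in>{0..2 * pi}. norm (K m s) \<le> \<kappa> m) \<and>
     (\<forall>m. 0 \<le> \<kappa> m) \<and> (\<Sum>m | mdeg m = mdeg m'. \<kappa> m) \<le> (real CARD('n) * r) ^ mdeg m' \<and>
     (\<forall>s\<in>{0..2 * pi}. \<forall>z. mpow (Q s *v z) m' = (\<Sum>m | mdeg m = mdeg m'. K m s * mpow z m))"
    (is "\<forall>m'. \<exists>K \<kappa>. ?P m' K \<kappa>")
    using bounded_form_mpow[OF Q] unfolding bounded_form_def by blast
  from choice[OF this] obtain K where "\<forall>m'. \<exists>\<kappa>. ?P m' (K m') \<kappa>" ..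
  from choice[OF this] obtain \<kappa> where "\<forall>m'. ?P m' (K m') (\<kappa> m')" ..
  then have K: "\<And>m' m. continuous_on {0..2 * pi} (K m' m)"
      "\<And>m' m s. s \<in> {0..2 * pi} \<Longrightarrow> norm (K m' m s) \<le> \<kappa> m' m"
      "\<And>m' m. 0 \<le> \<kappa> m' m" "\<And>m'. (\<Sum>m | mdeg m = mdeg m'. \<kappa> m' m) \<le> (real CARD('n) * r) ^ mdeg m'"
      "\<And>m' s z. s \<in> {0..2 * pi} \<Longrightarrow> mpow (Q s *v z) m' = (\<Sum>m | mdeg m = mdeg m'. K m' m s * mpow z m)"
    by blast+
  define c where "c m s = (\<Sum>m' | mdeg m' = mdeg m. K m' m s *s b m' s)" for m s
  note Kb = L2_circle_scale[OF continuous_imp_measurable_circle[OF K(1)] b K(2)]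
  show ?thesis
  proof
    show cL: "L2_circle (c m)" for m
      unfolding c_def by (intro L2_circle_sum Kb)
    show "L2_norm (c m) \<le> (\<Sum>m' | mdeg m' = mdeg m. \<kappa> m' m * L2_norm (b m'))" for m
      unfolding c_def by (rule order_trans[OF L2_norm_sum sum_mono]) (auto intro: Kb)
    show "norm (c m s) \<le> (\<Sum>m' | mdeg m' = mdeg m. \<kappa> m' m * norm (b m' s))" if "s \<in> {0..2 * pi}" for m s
      unfolding c_def
      by (intro sum_norm_le) (auto simp: norm_vector_scalar_mult intro: mult_right_mono[OF K(2)[OF that]])
    show "(\<Sum>m | mdeg m \<le> N. mpow z m *s c m s) = (\<Sum>m | mdeg m \<le> N. mpow (Q s *v z) m *s b m s)"
      if s: "s \<in> {0..2 * pi}" for s z N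
    proof -
      have "(\<Sum>m | mdeg m \<le> N. mpow z m *s c m s)
         = (\<Sum>m | mdeg m \<le> N. \<Sum>m' | mdeg m' = mdeg m. (K m' m s * mpow z m) *s b m' s)"
        unfolding c_def vec.scale_sum_right by (simp add: mult.commute)
      also have "\<dots> = (\<Sum>m' | mdeg m' \<le> N. \<Sum>m | mdeg m = mdeg m'. (K m' m s * mpow z m) *s b m' s)"
        by (rule sum_swap_multiindices)
      also have "\<dots> = (\<Sum>m' | mdeg m' \<le> N. mpow (Q s *v z) m' *s b m' s)"
        unfolding K(5)[OF s] vec.scale_sum_left ..
      finally show ?thesis .
    qed
  qed (use K in auto)
qed

section \<open>The expansion into eigenfunctions\<close>

lemma bounded_components_compact:
  fixes Q :: "'x::topological_space \<Rightarrow> complex^'n^'m"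
  assumes "compact X" "\<And>i j. continuous_on X (\<lambda>s. Q s $ i $ j)"
  obtains r where "0 \<le> r" "\<And>s i j. s \<in> X \<Longrightarrow> norm (Q s $ i $ j) \<le> r"
proof -
  have "continuous_on X (\<lambda>s. \<Sum>i\<in>UNIV. \<Sum>j\<in>UNIV. norm (Q s $ i $ j))"
    by (intro continuous_on_sum continuous_on_norm assms)
  then have "bounded ((\<lambda>s. \<Sum>i\<in>UNIV. \<Sum>j\<in>UNIV. norm (Q s $ i $ j)) ` X)"
    using assms(1) by (intro compact_imp_bounded compact_continuous_image)
  then obtain r where r: "\<And>s. s \<in> X \<Longrightarrow> (\<Sum>i\<in>UNIV. \<Sum>j\<in>UNIV. norm (Q s $ i $ j)) \<le> r"
    unfolding bounded_iff by (auto simp: abs_le_iff)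
  show ?thesis
  proof
    show "norm (Q s $ i $ j) \<le> max 0 r" if "s \<in> X" for s i j
    proof -
      have "norm (Q s $ i $ j) \<le> (\<Sum>j\<in>UNIV. norm (Q s $ i $ j))" by (rule member_le_sum) auto
      also have "\<dots> \<le> (\<Sum>i\<in>UNIV. \<Sum>j\<in>UNIV. norm (Q s $ i $ j))"
        by (rule member_le_sum) (auto intro: sum_nonneg)
      finally show ?thesis using r[OF that] by simp
    qed
  qed simp
qed

lemma of_real_vector_scalar_mult: "complex_of_real r *s v = r *\<^sub>R v"
  by (simp add: vec_eq_iff scaleR_conv_of_real[where 'a = complex])

lemma continuous_on_floquet_coord:
  fixes P :: "real \<Rightarrow> complex^'n^'n"
  assumes "floquet_form A P B" "invertible V"
    and "matrix_inv V ** B ** V = (\<chi> i j. if i = j then \<mu> $ i else 0)"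
  shows "continuous_on X (\<lambda>s. floquet_coord P V y s $ k)"
proof (rule continuous_on_linear_system)
  have P: "invertible (P s)" for s using assms(1) by (simp add: floquet_form_def)
  show "continuous_on X (\<lambda>s. (P s ** V) $ i $ j)" for i j
    by (rule continuous_on_subset[OF floquet_form_continuous[OF assms] subset_UNIV])
  show "invertible (P s ** V)" for s by (rule invertible_mult[OF P assms(2)])
  show "(P s ** V) *v floquet_coord P V y s = complex_vec y" for s
    by (rule floquet_coord_inverse[OF P assms(2)])
qed

text \<open>The columns of V^-1 P^-1(s) are the values of \<open>z\<close> at the unit vectors,
  hence continuous in the phase and bounded over one period; linearity in \<open>y\<close> gives the
  rest.\<close>

lemma floquet_coord_bound:
  fixes P :: "real \<Rightarrow> complex^'n^'n"
  assumes "floquet_form A P B" "invertible V"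
    and "matrix_inv V ** B ** V = (\<chi> i j. if i = j then \<mu> $ i else 0)"
  obtains \<zeta> where "0 \<le> \<zeta>" "\<And>y s k. s \<in> {0..2 * pi} \<Longrightarrow> norm (floquet_coord P V y s $ k) \<le> \<zeta> * norm y"
proof -
  let ?W = "\<lambda>s. matrix_inv V ** matrix_inv (P s)"
  have W: "floquet_coord P V y s = ?W s *v complex_vec y" for y s
    by (simp add: floquet_coord_def matrix_vector_mul_assoc)
  have "?W s $ k $ j = floquet_coord P V (axis j 1) s $ k" for s k j
    by (simp add: W matrix_vector_mult_def[of "?W s"] axis_def if_distrib cong: if_cong)
  then have "continuous_on {0..2 * pi} (\<lambda>s. ?W s $ k $ j)" for k j
    by (simp add: continuous_on_floquet_coord[OF assms])
  then obtain r where r: "0 \<le> r" "\<And>s k j. s \<in> {0..2 * pi} \<Longrightarrow> norm (?W s $ k $ j) \<le> r"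
    using bounded_components_compact[OF compact_Icc, of 0 "2 * pi" ?W] by blast
  show ?thesis
  proof
    show "0 \<le> real CARD('n) * r" using r(1) by simp
    fix y s k assume s: "s \<in> {0..2 * pi}"
    have "norm (floquet_coord P V y s $ k) = norm (\<Sum>j\<in>UNIV. ?W s $ k $ j * of_real (y $ j))"
      by (simp add: W matrix_vector_mult_def[of "?W s"])
    also have "\<dots> \<le> (\<Sum>j\<in>(UNIV :: 'n set). r * norm y)"
      using r(1) Finite_Cartesian_Product.norm_nth_le[of y]
      by (intro sum_norm_le) (simp add: norm_mult mult_mono r(2)[OF s])
    finally show "norm (floquet_coord P V y s $ k) \<le> real CARD('n) * r * norm y"
      by (simp add: mult.assoc)
  qed
qed

lemma ereal_scaled_radius:
  fixes R :: ereal and \<kappa> x :: real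
  assumes "1 \<le> \<kappa>" "ereal x < R / ereal \<kappa>"
  shows "ereal (\<kappa> * x) < R"
  using assms by (cases R) (auto simp: field_simps)

text \<open>The modes \<open>a m k\<close> are the Fourier coefficients of the phase-dependent
  coefficients \<open>c m\<close>. The expansion is given in three readings: summed by degree on the
  whole ball, unconditionally over \<open>m\<close> on a ball smaller by a constant factor, and
  jointly over \<open>(m, k)\<close> in L2. The last presupposes L2 convergence of the series in
  \<open>y\<close>, which does not follow from convergence at almost every phase.\<close>

theorem theorem8p1:
  fixes A :: "real \<Rightarrow> real^'n^'n"
    and P :: "real \<Rightarrow> complex^'n^'n"
    and B V :: "complex^'n^'n"
    and \<mu> :: "complex^'n"
    and S :: "real \<Rightarrow> (real^'n) \<times> real \<Rightarrow> (real^'n) \<times> real"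
    and R :: ereal
    and b :: "('n \<Rightarrow> nat) \<Rightarrow> real \<Rightarrow> complex^'q"
    and G :: "(real^'n) \<times> real \<Rightarrow> complex^'q"
  assumes "continuous_on UNIV A"
    and "\<forall>s. A (s + 2 * pi) = A s"
    and "flow_of (skew_field A) S"
    and "floquet_form A P B"
    and "invertible V"
    and "matrix_inv V ** B ** V = (\<chi> i j. if i = j then \<mu> $ i else 0)"
    and "\<forall>i j. i \<noteq> j \<longrightarrow> \<mu> $ i \<noteq> \<mu> $ j"
    and "0 < R"
    and "analytic_L2 R b G"
  shows
    "(\<forall>m k. koopman_eigenfunction S ((\<Sum>i\<in>UNIV. of_nat (m i) * \<mu> $ i) + \<i> * of_int k)
        (\<lambda>(y, s). mpow (floquet_coord P V y s) m * fourier_char k s)) \<and>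
     (\<exists>(a :: ('n \<Rightarrow> nat) \<Rightarrow> int \<Rightarrow> complex^'q) c \<rho>.
        (\<forall>m. L2_has_sum (\<lambda>k s. fourier_char k s *s a m k) (c m) UNIV) \<and>
        (AE s in circle_measure. \<forall>y. ereal (norm y) < R \<longrightarrow>
           (\<lambda>N. \<Sum>m | (\<Sum>i\<in>UNIV. m i) \<le> N. mpow (floquet_coord P V y s) m *s c m s) \<longlonglongrightarrow> G (y, s)) \<and>
        0 < \<rho> \<and> \<rho> \<le> R \<and> (R = \<infinity> \<longrightarrow> \<rho> = \<infinity>) \<and>
        (AE s in circle_measure. \<forall>y. ereal (norm y) < \<rho> \<longrightarrow>
           ((\<lambda>m. mpow (floquet_coord P V y s) m *s c m s) has_sum G (y, s)) UNIV) \<and>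
        ((\<forall>y. ereal (norm y) < R \<longrightarrow>
             L2_has_sum (\<lambda>m s. mpow y m *\<^sub>R b m s) (\<lambda>s. G (y, s)) UNIV) \<longrightarrow>
         (\<forall>y. ereal (norm y) < \<rho> \<longrightarrow>
             L2_has_sum (\<lambda>(m, k) s. (mpow (floquet_coord P V y s) m * fourier_char k s) *s a m k)
               (\<lambda>s. G (y, s)) UNIV)))"
proof (intro conjI allI)
  fix m k
  show "koopman_eigenfunction S ((\<Sum>i\<in>UNIV. of_nat (m i) * \<mu> $ i) + \<i> * of_int k)
        (\<lambda>(y, s). mpow (floquet_coord P V y s) m * fourier_char k s)"
    by (rule koopman_eigenfunction_mpow[OF assms(3-6)])
next
  let ?z = "floquet_coord P V"
  have P: "\<And>s. invertible (P s)" using assms(4) by (simp add: floquet_form_def)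
  note coord = floquet_coord_inverse[where P = P, OF P assms(5)]
  have Qcont: "continuous_on {0..2 * pi} (\<lambda>s. (P s ** V) $ i $ j)" for i j
    by (rule continuous_on_subset[OF floquet_form_continuous[OF assms(4-6)] subset_UNIV])
  obtain q where q: "0 \<le> q" "\<And>s i j. s \<in> {0..2 * pi} \<Longrightarrow> norm ((P s ** V) $ i $ j) \<le> q"
    using bounded_components_compact[OF compact_Icc Qcont] by blast
  obtain \<zeta> where \<zeta>: "0 \<le> \<zeta>" "\<And>y s k. s \<in> {0..2 * pi} \<Longrightarrow> norm (?z y s $ k) \<le> \<zeta> * norm y"
    using floquet_coord_bound[OF assms(4-6)] by blast
  have b: "\<And>m. L2_circle (b m)"
    and G: "AE s in circle_measure. \<forall>y. ereal (norm y) < R \<longrightarrow> ((\<lambda>m. mpow y m *\<^sub>R b m s) has_sum G (y, s)) UNIV"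
    using assms(9) by (auto simp: analytic_L2_def)
  define L where "L = real CARD('n) * q"
  have L: "0 \<le> L" using q(1) by (simp add: L_def)
  obtain c \<kappa> where c: "\<And>m. L2_circle (c m)"
    and sums: "\<And>s z N. s \<in> {0..2 * pi} \<Longrightarrow>
      (\<Sum>m | mdeg m \<le> N. mpow z m *s c m s) = (\<Sum>m | mdeg m \<le> N. mpow ((P s ** V) *v z) m *s b m s)"
    and \<kappa>: "\<And>m m'. 0 \<le> \<kappa> m' m" "\<And>m'. (\<Sum>m | mdeg m = mdeg m'. \<kappa> m' m) \<le> L ^ mdeg m'"
    and c_bound: "\<And>m s. s \<in> {0..2 * pi} \<Longrightarrow> norm (c m s) \<le> (\<Sum>m' | mdeg m' = mdeg m. \<kappa> m' m * norm (b m' s))"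
    and c_norm: "\<And>m. L2_norm (c m) \<le> (\<Sum>m' | mdeg m' = mdeg m. \<kappa> m' m * L2_norm (b m'))"
    using power_series_linear_substitution[of "\<lambda>s. P s ** V" q b, OF Qcont q(2,1) b] unfolding L_def by blast
  have sums': "(\<Sum>m | mdeg m \<le> N. mpow (?z y s) m *s c m s) = (\<Sum>m | mdeg m \<le> N. mpow y m *\<^sub>R b m s)"
    if "s \<in> {0..2 * pi}" for s y N
    by (simp add: sums[OF that] coord mpow_complex_vec of_real_vector_scalar_mult)
  define a where "a m k = (\<chi> i. fourier_coeff (\<lambda>s. c m s $ i) k)" for m k
  note fourier = fourier_series_vec[OF c, folded a_def]
  \<comment> \<open>\<open>\<zeta>\<close> bounds \<open>z\<close> in terms of \<open>y\<close>,
    \<open>L\<close> bounds the expanded forms, and \<open>CARD('n)\<close> is the cost of fitting a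
    diagonal point into a ball. The maximum with 1 ensures \<rho> \<le> R.\<close>
  define \<eta> where "\<eta> = max 1 (real CARD('n) * (L * \<zeta>))"
  define \<rho> where "\<rho> = R / ereal \<eta>"
  have \<eta>: "1 \<le> \<eta>" by (simp add: \<eta>_def)
  have \<rho>: "0 < \<rho>" "\<rho> \<le> R" "R = \<infinity> \<longrightarrow> \<rho> = \<infinity>"
    using \<open>0 < R\<close> \<eta> unfolding \<rho>_def
    by (cases R; simp add: field_simps mult_le_cancel_left1)+
  \<comment> \<open>At the diagonal point (t, ..., t) every monomial of degree d equals t^d, so
    convergence there bounds all coefficients of degree d by C / t^d. With \<open>T\<close> strictly
    between \<open>\<eta> * norm y\<close> and \<open>R\<close>, the choice t = T/n keeps this point
    inside the ball.\<close>
  have radius: "\<exists>t. L * (\<zeta> * norm y) < t \<and> ereal (norm (\<chi> i. t :: real^'n)) < R"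
    if y: "ereal (norm y) < \<rho>" for y :: "real^'n"
  proof -
    have "ereal (\<eta> * norm y) < R"
      using ereal_scaled_radius[OF \<eta>] y unfolding \<rho>_def .
    then obtain T where T: "ereal (\<eta> * norm y) < ereal T" "ereal T < R"
      using ereal_dense2 by blast
    have n: "0 < real CARD('n)" by simp
    have "real CARD('n) * (L * \<zeta>) * norm y \<le> \<eta> * norm y"
      by (intro mult_right_mono) (simp_all add: \<eta>_def)
    also have "\<dots> < T" using T by simp
    finally have 1: "L * (\<zeta> * norm y) < T / real CARD('n)"
      using n by (simp add: field_simps)
    moreover have "0 \<le> L * (\<zeta> * norm y)" using L \<zeta> by simp
    ultimately have "0 < T / real CARD('n)" by linarith
    then have "0 < T" using n by (simp add: zero_less_divide_iff)
    then have "norm (\<chi> i. T / real CARD('n) :: real^'n) \<le> T"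
      using norm_le_l1_cart[of "\<chi> i. T / real CARD('n) :: real^'n"] by simp
    then have "ereal (norm (\<chi> i. T / real CARD('n) :: real^'n)) < R"
      using T(2) by (meson ereal_less_eq(3) le_less_trans)
    with 1 show ?thesis by blast
  qed
  have mpow_bound: "norm (mpow (?z y s) m) \<le> (\<zeta> * norm y) ^ mdeg m" if "s \<in> {0..2 * pi}" for y s m
    by (intro norm_mpow_le \<zeta> that)
  have limit: "AE s in circle_measure. \<forall>y. ereal (norm y) < R \<longrightarrow>
      (\<lambda>N. \<Sum>m | mdeg m \<le> N. mpow (?z y s) m *s c m s) \<longlonglongrightarrow> G (y, s)"
    using G AE_space
  proof eventually_elim
    case (elim s)
    show ?case
    proof (intro allI impI)
      fix y :: "real^'n" assume "ereal (norm y) < R"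
      then have "(sum (\<lambda>m. mpow y m *\<^sub>R b m s) \<longlongrightarrow> G (y, s)) (finite_subsets_at_top UNIV)"
        using elim by (simp add: has_sum_def)
      from filterlim_compose[OF this filterlim_multiindices_le]
      show "(\<lambda>N. \<Sum>m | mdeg m \<le> N. mpow (?z y s) m *s c m s) \<longlonglongrightarrow> G (y, s)"
        using elim by (simp add: sums')
    qed
  qed
  have absolute: "AE s in circle_measure. \<forall>y. ereal (norm y) < \<rho> \<longrightarrow>
      ((\<lambda>m. mpow (?z y s) m *s c m s) has_sum G (y, s)) UNIV"
    using G limit AE_space
  proof eventually_elim
    case (elim s)
    then have s: "s \<in> {0..2 * pi}" by simp
    show ?case
    proof (intro allI impI)
      fix y :: "real^'n" assume y: "ereal (norm y) < \<rho>"
      then obtain t where t: "L * (\<zeta> * norm y) < t" "ereal (norm (\<chi> i. t :: real^'n)) < R"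
        using radius by blast
      have t0: "0 < t" using t(1) L \<zeta>(1) by (meson le_less_trans mult_nonneg_nonneg norm_ge_zero)
      obtain C where "\<And>m. norm (mpow (\<chi> i. t :: real^'n) m *\<^sub>R b m s) \<le> C"
        using has_sum_bounded_terms elim(1) t(2) by blast
      then have C: "norm (b m s) * t ^ mdeg m \<le> C" for m
        using t0 by (simp add: mpow_const mult.commute)
      have "(\<lambda>m. norm (c m s) * (\<zeta> * norm y) ^ mdeg m) summable_on UNIV"
        by (rule summable_on_power_series_substitution[where \<kappa> = \<kappa> and L = L and \<beta> = "\<lambda>m. norm (b m s)"])
          (use \<kappa> C c_bound[OF s] t L \<zeta>(1) in auto)
      then have "(\<lambda>m. mpow (?z y s) m *s c m s) summable_on UNIV"
        by (rule abs_summable_summable[OF summable_on_comparison_test])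
          (use mpow_bound[OF s] in \<open>auto simp: norm_vector_scalar_mult mult.commute intro!: mult_left_mono\<close>)
      \<comment> \<open>Absolute convergence provides only some sum \<open>l\<close>; the limit of
        the truncations by degree, already known on the larger ball, identifies it.\<close>
      then obtain l where l: "((\<lambda>m. mpow (?z y s) m *s c m s) has_sum l) UNIV"
        by (auto simp: summable_on_def)
      then have "(sum (\<lambda>m. mpow (?z y s) m *s c m s) \<longlongrightarrow> l) (finite_subsets_at_top UNIV)"
        by (simp add: has_sum_def)
      from filterlim_compose[OF this filterlim_multiindices_le]
      have "(\<lambda>N. \<Sum>m | mdeg m \<le> N. mpow (?z y s) m *s c m s) \<longlonglongrightarrow> l" .
      moreover have "ereal (norm y) < R" using y \<rho>(2) by (rule less_le_trans)
      ultimately have "l = G (y, s)" using elim(2) LIMSEQ_unique by blast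
      with l show "((\<lambda>m. mpow (?z y s) m *s c m s) has_sum G (y, s)) UNIV" by simp
    qed
  qed
  have double: "L2_has_sum (\<lambda>(m, k) s. (mpow (?z y s) m * fourier_char k s) *s a m k) (\<lambda>s. G (y, s)) UNIV"
    if hyp: "\<And>y. ereal (norm y) < R \<Longrightarrow> L2_has_sum (\<lambda>m s. mpow y m *\<^sub>R b m s) (\<lambda>s. G (y, s)) UNIV"
      and y: "ereal (norm y) < \<rho>" for y
  proof -
    obtain t where t: "L * (\<zeta> * norm y) < t" "ereal (norm (\<chi> i. t :: real^'n)) < R"
      using radius[OF y] by blast
    have t0: "0 < t" using t(1) L \<zeta>(1) by (meson le_less_trans mult_nonneg_nonneg norm_ge_zero)
    \<comment> \<open>The same coefficient estimate for L2 norms: at the fixed diagonal point a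
      monomial is a constant in \<open>s\<close> and comes out of the norm.\<close>
    obtain C where "\<And>m. L2_norm (\<lambda>s. mpow (\<chi> i. t :: real^'n) m *\<^sub>R b m s) \<le> C"
      using L2_has_sum_bounded_terms[OF hyp[OF t(2)]] by blast
    moreover have "L2_norm (\<lambda>s. mpow (\<chi> i. t :: real^'n) m *\<^sub>R b m s) = L2_norm (b m) * t ^ mdeg m" for m
      using t0 by (simp add: mpow_const L2_norm_def power_mult_distrib real_sqrt_mult mult.commute)
    ultimately have C: "L2_norm (b m) * t ^ mdeg m \<le> C" for m by simp
    have w: "(\<lambda>m. L2_norm (c m) * (\<zeta> * norm y) ^ mdeg m) summable_on UNIV"
      by (rule summable_on_power_series_substitution[where \<kappa> = \<kappa> and L = L and \<beta> = "\<lambda>m. L2_norm (b m)"])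
        (use \<kappa> C c_norm t L \<zeta>(1) in auto)
    have yR: "ereal (norm y) < R" using y \<rho>(2) by (rule less_le_trans)
    have GL: "L2_circle (\<lambda>s. G (y, s))"
      and "((\<lambda>F. L2_norm (\<lambda>s. G (y, s) - (\<Sum>m\<in>F. mpow y m *\<^sub>R b m s))) \<longlongrightarrow> 0) (finite_subsets_at_top UNIV)"
      using hyp[OF yR] by (auto simp: L2_has_sum_def)
    from filterlim_compose[OF this(2) filterlim_multiindices_le]
    have "(\<lambda>N. L2_norm (\<lambda>s. G (y, s) - (\<Sum>m | mdeg m \<le> N. mpow y m *\<^sub>R b m s))) \<longlonglongrightarrow> 0" .
    \<comment> \<open>The two truncated sums agree at every phase of one period, which is the domain
      of integration.\<close>
    moreover have "L2_norm (\<lambda>s. G (y, s) - (\<Sum>m | mdeg m \<le> N. mpow (?z y s) m *s c m s))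
        = L2_norm (\<lambda>s. G (y, s) - (\<Sum>m | mdeg m \<le> N. mpow y m *\<^sub>R b m s))" for N
      unfolding L2_norm_def
      by (rule arg_cong[of _ _ sqrt], rule Bochner_Integration.integral_cong) (simp_all add: sums')
    ultimately have lim: "(\<lambda>N. L2_norm (\<lambda>s. G (y, s) - (\<Sum>m | mdeg m \<le> N. mpow (?z y s) m *s c m s))) \<longlonglongrightarrow> 0"
      by simp
    have meas: "(\<lambda>s. mpow (?z y s) m) \<in> borel_measurable circle_measure" for m
      unfolding mpow_def
      by (intro continuous_imp_measurable_circle continuous_intros continuous_on_floquet_coord[OF assms(4-6)])
    have "L2_has_sum (\<lambda>(m, k) s. mpow (?z y s) m *s (fourier_char k s *s a m k)) (\<lambda>s. G (y, s)) UNIV"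
    proof (rule L2_has_sum_double[where M = "\<lambda>m. (\<zeta> * norm y) ^ mdeg m" and u = "\<lambda>m s. mpow (?z y s) m"
          and f = "\<lambda>m k s. fourier_char k s *s a m k"])
      show "(\<lambda>m. (\<zeta> * norm y) ^ mdeg m * L2_norm (c m)) summable_on UNIV"
        using w by (simp add: mult.commute)
    qed (fact meas mpow_bound fourier filterlim_multiindices_le GL lim)+
    then show ?thesis by (simp add: vector_smult_assoc)
  qed
  show "\<exists>(a :: ('n \<Rightarrow> nat) \<Rightarrow> int \<Rightarrow> complex^'q) c \<rho>.
        (\<forall>m. L2_has_sum (\<lambda>k s. fourier_char k s *s a m k) (c m) UNIV) \<and>
        (AE s in circle_measure. \<forall>y. ereal (norm y) < R \<longrightarrow>
           (\<lambda>N. \<Sum>m | (\<Sum>i\<in>UNIV. m i) \<le> N. mpow (floquet_coord P V y s) m *s c m s) \<longlonglongrightarrow> G (y, s)) \<and>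
        0 < \<rho> \<and> \<rho> \<le> R \<and> (R = \<infinity> \<longrightarrow> \<rho> = \<infinity>) \<and>
        (AE s in circle_measure. \<forall>y. ereal (norm y) < \<rho> \<longrightarrow>
           ((\<lambda>m. mpow (floquet_coord P V y s) m *s c m s) has_sum G (y, s)) UNIV) \<and>
        ((\<forall>y. ereal (norm y) < R \<longrightarrow>
             L2_has_sum (\<lambda>m s. mpow y m *\<^sub>R b m s) (\<lambda>s. G (y, s)) UNIV) \<longrightarrow>
         (\<forall>y. ereal (norm y) < \<rho> \<longrightarrow>
             L2_has_sum (\<lambda>(m, k) s. (mpow (floquet_coord P V y s) m * fourier_char k s) *s a m k)
               (\<lambda>s. G (y, s)) UNIV))"
    by (intro exI[of _ a] exI[of _ c] exI[of _ \<rho>] conjI impI allI fourier(1) limit \<rho> absolute double) auto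
qed

end
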